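(* Assume that there exist $0<q<1$ and $C>0$ such that $b_k\le Cq^k$ for all $k\ge1$, and let the arrival intensity $\lambda(t)$ and the service intensity $\mu(t)$ be $1$-periodic. Then the condition $\int_0^\infty\mu(t)\,dt=+\infty$ is equivalent to $\int_0^1\mu(t)\,dt>0$. Moreover, if this condition holds, the limiting probability distribution of $X(t)$ is $1$-periodic, i.e. there is a $1$-periodic solution $\boldsymbol\pi(t)$ of the forward Kolmogorov system consisting of probability vectors such that $\|\mathbf p(t)-\boldsymbol\pi(t)\|\to0$ as $t\to\infty$ for every initial probability vector $\mathbf p(0)$; and the limiting mean is $1$-periodic as well, i.e. there is a $1$-periodic function $\phi(t)$ such that $E(t,k)-\phi(t)\to0$ as $t\to\infty$ for every $k\in\mathcal X$.
   Context: Queue model. Let $\lambda,\mu:[0,\infty)\to[0,\infty)$ be non-random locally integrable functions with $\lambda(t)\le L<\infty$ for all $t\ge0$. Let $\{b_n,\ n\ge1\}$ be a probability distribution on $\{1,2,\dots\}$ (batch sizes) with finite mean, and put $B_k=\sum_{n\ge k}b_n$ (so $B_1=1$). Customers arrive in batches according to a Poisson process of intensity $\lambda(t)$; batch sizes are distributed as $\{b_n\}$. A batch whose size is strictly larger than the current number of customers replaces all the customers in the system; otherwise it is lost. Customers are served one by one with intensity $\mu(t)$. $X(t)$ is the number of customers at time $t$: it is a continuous-time Markov chain on $\mathcal X=\{0,1,\dots,b^*\}$, where $b^*=\max\{n: b_n>0\}$ (with $\mathcal X=\{0,1,2,\dots\}$ if the batch size has infinite support). Its transition intensities $q_{ij}(t)$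 are: $q_{ij}(t)=\lambda(t)b_j$ for $j>i$; $q_{i,i-1}(t)=\mu(t)$ for $i\ge1$; $q_{00}(t)=-\lambda(t)$; $q_{ii}(t)=-(\mu(t)+\lambda(t)B_{i+1})$ for $i\ge1$; all others $0$ (with indices restricted to $\mathcal X$). Let $Q(t)=(q_{ij}(t))$ and $A(t)=Q(t)^T$. The probability vector $\mathbf p(t)=(p_0(t),p_1(t),\dots)^T$, $p_i(t)=\mathbf P(X(t)=i)$, satisfies the forward Kolmogorov system $\frac{d}{dt}\mathbf p(t)=A(t)\mathbf p(t)$, understood for $l_1$-valued solutions (for almost every $t$, since the coefficients are only locally integrable). $\|\cdot\|$ is the $l_1$-norm. $E(t,k)=\sum_{n\in\mathcal X}n\,p_n(t)$ is the mean number of customers at time $t$ given $p_k(0)=1$. *)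

theory Defs
  imports "HOL-Analysis.Analysis"
begin

definition batch_tail :: "(nat \<Rightarrow> real) \<Rightarrow> nat \<Rightarrow> real" where
  "batch_tail b k = (\<Sum>n. b (n + k))"

definition batch_distribution :: "(nat \<Rightarrow> real) \<Rightarrow> bool" where
  "batch_distribution b \<longleftrightarrow>
     (\<forall>n. 0 \<le> b n) \<and> b 0 = 0 \<and> b sums 1 \<and> summable (\<lambda>n. real n * b n)"

definition state_space :: "(nat \<Rightarrow> real) \<Rightarrow> nat set" where
  "state_space b = (if finite {n. b n > 0} then {0..Max {n. b n > 0}} else UNIV)"

definition intensity ::
  "(nat \<Rightarrow> real) \<Rightarrow> (real \<Rightarrow> real) \<Rightarrow> (real \<Rightarrow> real) \<Rightarrow> real \<Rightarrow> nat \<Rightarrow> nat \<Rightarrow> real" where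
  "intensity b lam mu t i j =
     (if i \<notin> state_space b \<or> j \<notin> state_space b then 0
      else if i < j then lam t * b j
      else if i = Suc j then mu t
      else if i = j then (if i = 0 then - lam t else - (mu t + lam t * batch_tail b (i + 1)))
      else 0)"

text \<open>The vector \<open>A(t) x\<close> with \<open>A(t)\<close> the transpose of the intensity matrix.\<close>

definition forward_operator ::
  "(nat \<Rightarrow> real) \<Rightarrow> (real \<Rightarrow> real) \<Rightarrow> (real \<Rightarrow> real) \<Rightarrow> real \<Rightarrow> (nat \<Rightarrow> real) \<Rightarrow> nat \<Rightarrow> real" where
  "forward_operator b lam mu t x j = (\<Sum>i. intensity b lam mu t i j * x i)"

text \<open>Vectors indexed by the state space are functions on \<open>nat\<close> vanishing outside of it,
  so that sums over the state space are sums over \<open>nat\<close>.\<close>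

definition l1_vector :: "(nat \<Rightarrow> real) \<Rightarrow> (nat \<Rightarrow> real) \<Rightarrow> bool" where
  "l1_vector b x \<longleftrightarrow> (\<forall>n. n \<notin> state_space b \<longrightarrow> x n = 0) \<and> summable (\<lambda>n. \<bar>x n\<bar>)"

definition l1_norm :: "(nat \<Rightarrow> real) \<Rightarrow> real" where
  "l1_norm x = (\<Sum>n. \<bar>x n\<bar>)"

definition probability_vector :: "(nat \<Rightarrow> real) \<Rightarrow> (nat \<Rightarrow> real) \<Rightarrow> bool" where
  "probability_vector b x \<longleftrightarrow>
     (\<forall>n. n \<notin> state_space b \<longrightarrow> x n = 0) \<and> (\<forall>n. 0 \<le> x n) \<and> x sums 1"

definition mean :: "(nat \<Rightarrow> real) \<Rightarrow> real" where
  "mean x = (\<Sum>n. real n * x n)"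

text \<open>The members of \<open>d\<close> below are non-overlapping compact intervals.\<close>

definition locally_absolutely_continuous_l1 :: "(real \<Rightarrow> nat \<Rightarrow> real) \<Rightarrow> bool" where
  "locally_absolutely_continuous_l1 p \<longleftrightarrow>
     (\<forall>T>0. \<forall>\<epsilon>>0. \<exists>\<delta>>0. \<forall>d S. d division_of S \<longrightarrow> S \<subseteq> {0..T} \<longrightarrow> (\<Sum>I\<in>d. Sup I - Inf I) < \<delta> \<longrightarrow>
        (\<Sum>I\<in>d. l1_norm (\<lambda>n. p (Sup I) n - p (Inf I) n)) < \<epsilon>)"

text \<open>Since the coefficients are only locally integrable, solutions on \<open>[0,\<infinity>)\<close> are meant in the
  sense of Caratheodory: locally absolutely continuous in \<open>l\<^sub>1\<close>, with the differential equation
  holding for almost every \<open>t\<close>, the derivative being taken in the \<open>l\<^sub>1\<close> norm.\<close>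

definition forward_solution ::
  "(nat \<Rightarrow> real) \<Rightarrow> (real \<Rightarrow> real) \<Rightarrow> (real \<Rightarrow> real) \<Rightarrow> (real \<Rightarrow> nat \<Rightarrow> real) \<Rightarrow> bool" where
  "forward_solution b lam mu p \<longleftrightarrow>
     (\<forall>t\<ge>0. l1_vector b (p t)) \<and>
     locally_absolutely_continuous_l1 p \<and>
     (AE t in lebesgue. t \<ge> 0 \<longrightarrow>
        ((\<lambda>s. l1_norm (\<lambda>n. (p s n - p t n) / (s - t) - forward_operator b lam mu t (p t) n))
           \<longlongrightarrow> 0) (at t within {0..}))"

end

(*
The probabilities T_k of having more than k customers form a bidiagonal system

  T_k' = lam B_(k+1) (1 - T_k) - mu (T_k - T_(k+1)),

because batches only ever push the number of customers upwards through a maximum. Differences of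
two solutions therefore satisfy the homogeneous system g_k' = - (lam B_(k+1) + mu) g_k + mu g_(k+1),
which has a maximum principle: a nonincreasing bound S_k on |g_k(0)| persists for all times. Since
mu has infinite integral, the limes superior of |g_k| is at most that of |g_(k+1)|, hence at most
S_m for all m, hence zero. This gives weak ergodicity for arbitrary initial vectors, and for a
deterministic initial state S_k is summable, which gives convergence of the means by dominated
convergence.

The periodic solution is the increasing limit of an iteration from T = 0 in which every step solves
a scalar linear equation periodically. It is dominated by q^k times a periodic function (a
supersolution of the system), which gives summability and the derivative in the l1 norm.
*)

theory Submission
  imports Defs
begin

section \<open>Absolutely continuous functions on the half-line\<close>

text \<open>Service may be unbounded and the equations hold only almost everywhere, and operator
  norms give only bounds that grow with time. So every comparison is an integrating factor argument
  resting on one fact: an absolutely continuous function with nonnegative derivative almost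
  everywhere is nondecreasing. The system is infinite and each component is driven by the next one,
  so there is no last component to start from. In the maximum principle a crude bound uniform in
  \<open>k\<close> takes that role, and a factor below 1 gained at each passage wears it out. The
  same principle shows that a solution starting from a probability vector stays one, which
  \<open>forward_solution\<close> does not include. Origin of the supersolution: inserting q^k e(t)
  into the tail equations asks for e' >= -(1 - q) mu e plus a share for the arrivals. A periodic e
  needs a logarithmic derivative of mean zero, which suggests e'/e = -(1 - q) (mu - m) with m the
  integral of mu over one period; the surplus (1 - q) m e then pays for the arrivals once e is large
  enough.\<close>

definition ac_on :: "real \<Rightarrow> (real \<Rightarrow> real) \<Rightarrow> bool" where
  "ac_on T f \<longleftrightarrow>
     (\<forall>\<epsilon>>0. \<exists>\<delta>>0. \<forall>d S. d division_of S \<longrightarrow> S \<subseteq> {0..T} \<longrightarrow> (\<Sum>I\<in>d. Sup I - Inf I) < \<delta> \<longrightarrow>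
        (\<Sum>I\<in>d. \<bar>f (Sup I) - f (Inf I)\<bar>) < \<epsilon>)"

lemma division_of_real_interval:
  fixes d :: "real set set"
  assumes "d division_of S" "S \<subseteq> {0..T}" "I \<in> d"
  shows "0 \<le> Inf I" "Inf I \<le> Sup I" "Sup I \<le> T" "I = {Inf I..Sup I}"
proof -
  obtain u v where "I = cbox u v" "I \<noteq> {}" "I \<subseteq> S"
    using division_ofD[OF assms(1)] assms(3) by metis
  moreover have "u \<le> v" using calculation by auto
  ultimately have *: "Inf I = u" "Sup I = v" "u \<le> v" "u \<in> S" "v \<in> S" "I = {u..v}" by auto
  then show "0 \<le> Inf I" "Inf I \<le> Sup I" "Sup I \<le> T" "I = {Inf I..Sup I}"
    using assms(2) by auto
qed

text \<open>Summing the pointwise bound over a division gives half of the tolerance to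
  \<open>g\<close> and half to \<open>h\<close>. Sums, products, exponentials and changes off the
  half-line are all instances.\<close>

lemma ac_on_dominated:
  assumes g: "ac_on T g" and h: "ac_on T h"
    and le: "\<And>x y. 0 \<le> x \<Longrightarrow> x \<le> y \<Longrightarrow> y \<le> T \<Longrightarrow> \<bar>f y - f x\<bar> \<le> K * \<bar>g y - g x\<bar> + K * \<bar>h y - h x\<bar>"
  shows "ac_on T f"
  unfolding ac_on_def
proof (intro allI impI)
  fix e :: real assume e: "e > 0"
  define K' where "K' = max K 1"
  have K': "K' > 0" "K \<le> K'" by (auto simp: K'_def)
  have e2: "e / (2 * K') > 0" using e K' by simp
  obtain d1 where d1: "d1 > 0" "\<And>d S. d division_of S \<Longrightarrow> S \<subseteq> {0..T} \<Longrightarrow> (\<Sum>I\<in>d. Sup I - Inf I) < d1 \<Longrightarrow>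
        (\<Sum>I\<in>d. \<bar>g (Sup I) - g (Inf I)\<bar>) < e / (2 * K')"
    using g[unfolded ac_on_def] e2 by blast
  obtain d2 where d2: "d2 > 0" "\<And>d S. d division_of S \<Longrightarrow> S \<subseteq> {0..T} \<Longrightarrow> (\<Sum>I\<in>d. Sup I - Inf I) < d2 \<Longrightarrow>
        (\<Sum>I\<in>d. \<bar>h (Sup I) - h (Inf I)\<bar>) < e / (2 * K')"
    using h[unfolded ac_on_def] e2 by blast
  show "\<exists>\<delta>>0. \<forall>d S. d division_of S \<longrightarrow> S \<subseteq> {0..T} \<longrightarrow> (\<Sum>I\<in>d. Sup I - Inf I) < \<delta> \<longrightarrow>
        (\<Sum>I\<in>d. \<bar>f (Sup I) - f (Inf I)\<bar>) < e"
  proof (intro exI[of _ "min d1 d2"] conjI allI impI)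
    show "0 < min d1 d2" using d1 d2 by simp
    fix d S assume d: "d division_of S" "S \<subseteq> {0..T}" "(\<Sum>I\<in>d. Sup I - Inf I) < min d1 d2"
    have "(\<Sum>I\<in>d. \<bar>f (Sup I) - f (Inf I)\<bar>) \<le>
        (\<Sum>I\<in>d. K' * \<bar>g (Sup I) - g (Inf I)\<bar> + K' * \<bar>h (Sup I) - h (Inf I)\<bar>)"
    proof (rule sum_mono)
      fix I assume "I \<in> d"
      then have "\<bar>f (Sup I) - f (Inf I)\<bar> \<le> K * \<bar>g (Sup I) - g (Inf I)\<bar> + K * \<bar>h (Sup I) - h (Inf I)\<bar>"
        using division_of_real_interval[OF d(1,2)] by (intro le) auto
      also have "\<dots> \<le> K' * \<bar>g (Sup I) - g (Inf I)\<bar> + K' * \<bar>h (Sup I) - h (Inf I)\<bar>"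
        using K' by (intro add_mono mult_right_mono) auto
      finally show "\<bar>f (Sup I) - f (Inf I)\<bar> \<le> K' * \<bar>g (Sup I) - g (Inf I)\<bar> + K' * \<bar>h (Sup I) - h (Inf I)\<bar>" .
    qed
    also have "\<dots> = K' * (\<Sum>I\<in>d. \<bar>g (Sup I) - g (Inf I)\<bar>) + K' * (\<Sum>I\<in>d. \<bar>h (Sup I) - h (Inf I)\<bar>)"
      by (simp add: sum.distrib sum_distrib_left)
    also have "\<dots> < K' * (e / (2 * K')) + K' * (e / (2 * K'))"
      using d d1 d2 K' by (intro add_strict_mono mult_strict_left_mono) auto
    also have "\<dots> = e" using K' by (simp add: field_simps)
    finally show "(\<Sum>I\<in>d. \<bar>f (Sup I) - f (Inf I)\<bar>) < e" .
  qed
qed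

lemma ac_on_continuous:
  assumes "ac_on T f"
  shows "continuous_on {0..T} f"
  unfolding continuous_on_iff
proof (intro ballI allI impI)
  fix x e :: real assume x: "x \<in> {0..T}" and e: "e > 0"
  obtain \<delta> where \<delta>: "\<delta> > 0" "\<And>d S. d division_of S \<Longrightarrow> S \<subseteq> {0..T} \<Longrightarrow> (\<Sum>I\<in>d. Sup I - Inf I) < \<delta> \<Longrightarrow>
        (\<Sum>I\<in>d. \<bar>f (Sup I) - f (Inf I)\<bar>) < e"
    using assms[unfolded ac_on_def] e by blast
  have *: "\<bar>f v - f u\<bar> < e" if "0 \<le> u" "u \<le> v" "v \<le> T" "v - u < \<delta>" for u v
    using \<delta>(2)[of "{{u..v}}" "{u..v}"] division_of_self[of u v] that by simp
  show "\<exists>d>0. \<forall>x'\<in>{0..T}. dist x' x < d \<longrightarrow> dist (f x') (f x) < e"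
  proof (intro exI[of _ \<delta>] conjI ballI impI)
    fix y assume "y \<in> {0..T}" "dist y x < \<delta>"
    then show "dist (f y) (f x) < e"
      using *[of x y] *[of y x] x by (cases "x \<le> y") (auto simp: dist_real_def abs_minus_commute)
  qed (use \<delta> in auto)
qed

lemma ac_on_bounded:
  assumes "ac_on T f"
  obtains K where "K > 0" "\<And>x. 0 \<le> x \<Longrightarrow> x \<le> T \<Longrightarrow> \<bar>f x\<bar> \<le> K"
proof -
  have "bounded (f ` {0..T})"
    using ac_on_continuous[OF assms] by (intro compact_imp_bounded compact_continuous_image) auto
  then show ?thesis
    using that unfolding bounded_pos by (auto simp: image_iff)
qed

lemma ac_on_const: "ac_on T (\<lambda>x. c)"
  unfolding ac_on_def by (auto intro!: exI[of _ 1])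

lemma ac_on_add: "ac_on T f \<Longrightarrow> ac_on T g \<Longrightarrow> ac_on T (\<lambda>x. f x + g x)"
  by (rule ac_on_dominated[where K = 1 and g = f and h = g]) auto

lemma ac_on_mult:
  assumes f: "ac_on T f" and g: "ac_on T g"
  shows "ac_on T (\<lambda>x. f x * g x)"
proof -
  obtain K1 where K1: "K1 > 0" "\<And>x. 0 \<le> x \<Longrightarrow> x \<le> T \<Longrightarrow> \<bar>f x\<bar> \<le> K1" using ac_on_bounded[OF f] by metis
  obtain K2 where K2: "K2 > 0" "\<And>x. 0 \<le> x \<Longrightarrow> x \<le> T \<Longrightarrow> \<bar>g x\<bar> \<le> K2" using ac_on_bounded[OF g] by metis
  show ?thesis
  proof (rule ac_on_dominated[OF f g, where K = "K1 + K2"])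
    fix x y assume xy: "0 \<le> x" "x \<le> y" "y \<le> T"
    have "\<bar>f y * g y - f x * g x\<bar> = \<bar>(f y - f x) * g y + f x * (g y - g x)\<bar>"
      by (simp add: algebra_simps)
    also have "\<dots> \<le> \<bar>f y - f x\<bar> * \<bar>g y\<bar> + \<bar>f x\<bar> * \<bar>g y - g x\<bar>"
      by (metis abs_mult abs_triangle_ineq)
    also have "\<dots> \<le> \<bar>f y - f x\<bar> * (K1 + K2) + (K1 + K2) * \<bar>g y - g x\<bar>"
      using K1(2)[of x] K2(2)[of y] K1(1) K2(1) xy
      by (intro add_mono mult_left_mono mult_right_mono) auto
    finally show "\<bar>f y * g y - f x * g x\<bar> \<le> (K1 + K2) * \<bar>f y - f x\<bar> + (K1 + K2) * \<bar>g y - g x\<bar>"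
      by (simp add: mult.commute)
  qed
qed

text \<open>On the bounded range of \<open>f\<close> the exponential is Lipschitz with constant
  \<open>exp K\<close>, by the tangent inequality 1 + x <= exp x.\<close>

lemma ac_on_exp:
  assumes f: "ac_on T f"
  shows "ac_on T (\<lambda>x. exp (f x))"
proof -
  obtain K where K: "K > 0" "\<And>x. 0 \<le> x \<Longrightarrow> x \<le> T \<Longrightarrow> \<bar>f x\<bar> \<le> K" using ac_on_bounded[OF f] by metis
  have lip: "\<bar>exp v - exp u\<bar> \<le> exp K * \<bar>v - u\<bar>" if "u \<le> K" "v \<le> K" for u v :: real
  proof -
    have *: "exp v - exp u \<le> exp K * (v - u)" if "u \<le> v" "v \<le> K" for u v :: real
    proof -
      have "exp v * (1 + (u - v)) \<le> exp v * exp (u - v)"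
        using exp_ge_add_one_self[of "u - v"] by (intro mult_left_mono) auto
      then have "exp v - exp u \<le> exp v * (v - u)" by (simp add: exp_diff algebra_simps)
      also have "\<dots> \<le> exp K * (v - u)" using that by (intro mult_right_mono) auto
      finally show ?thesis .
    qed
    show ?thesis
      using *[of u v] *[of v u] that by (cases "u \<le> v") (auto simp: abs_if)
  qed
  show ?thesis
    by (rule ac_on_dominated[OF f ac_on_const, where K = "exp K"])
       (use K lip in \<open>auto simp: abs_le_iff\<close>)
qed

section \<open>Absolute continuity of indefinite integrals\<close>

lemma division_integral_le:
  fixes h :: "real \<Rightarrow> real"
  assumes d: "d division_of S" "S \<subseteq> {0..T}" and h: "h integrable_on {0..T}"
    and nonneg: "\<And>x. x \<in> {0..T} \<Longrightarrow> 0 \<le> h x"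
  shows "(\<Sum>I\<in>d. integral I h) \<le> integral {0..T} h"
proof -
  have int: "h integrable_on I" if "I \<in> d" for I
    using division_of_real_interval[OF d that] h by (metis integrable_subinterval_real atLeastatMost_subset_iff)
  have "(\<Sum>I\<in>d. integral I h) = integral S h"
    using integral_combine_division_bottomup[OF d(1) int] by simp
  also have "\<dots> \<le> integral {0..T} h"
    using integrable_combine_division[OF d(1) int] d h nonneg by (intro integral_subset_le) auto
  finally show ?thesis .
qed

lemma integral_diff_Icc:
  fixes h :: "real \<Rightarrow> real"
  assumes "h integrable_on {0..T}" "0 \<le> x" "x \<le> y" "y \<le> T"
  shows "integral {0..y} h - integral {0..x} h = integral {x..y} h"
proof -
  have "h integrable_on {0..y}"
    using assms by (metis integrable_subinterval_real atLeastatMost_subset_iff order_refl order_trans)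
  from Henstock_Kurzweil_Integration.integral_combine[OF assms(2,3) this] show ?thesis by simp
qed

lemma absolutely_integrable_on_min_const:
  fixes h :: "real \<Rightarrow> real"
  assumes h: "h absolutely_integrable_on {0..T}"
  shows "(\<lambda>x. min \<bar>h x\<bar> c) integrable_on {0..T}"
proof -
  have 1: "(\<lambda>x. \<bar>h x\<bar>) absolutely_integrable_on {0..T}"
    using absolutely_integrable_abs h by (auto intro: absolutely_integrable_norm[OF h, unfolded o_def, simplified])
  show ?thesis
    using absolutely_integrable_min_1[OF 1, of "\<lambda>_. c"] absolutely_integrable_on_const[of "{0..T}" c]
    by (auto simp: absolutely_integrable_on_def)
qed

text \<open>Truncation at height N: the part min |h| N contributes at most N times the total length
  of the division, and by dominated convergence N can be chosen so that the rest has integral below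
  \<open>e / 2\<close> over all of \<open>{0..T}\<close>, hence over any division.\<close>

lemma ac_on_integral:
  assumes h: "h absolutely_integrable_on {0..T}"
  shows "ac_on T (\<lambda>t. integral {0..t} h)"
  unfolding ac_on_def
proof (intro allI impI)
  fix e :: real assume e: "e > 0"
  define g where "g = (\<lambda>n x. min \<bar>h x\<bar> (real n))"
  have g: "g n integrable_on {0..T}" for n
    unfolding g_def by (rule absolutely_integrable_on_min_const[OF h])
  have ah: "(\<lambda>x. \<bar>h x\<bar>) integrable_on {0..T}" and ih: "h integrable_on {0..T}"
    using h by (auto simp: absolutely_integrable_on_def)
  have "(\<lambda>n. integral {0..T} (g n)) \<longlonglongrightarrow> integral {0..T} (\<lambda>x. \<bar>h x\<bar>)"
  proof (rule dominated_convergence(2)[OF g ah])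
    show "norm (g n x) \<le> \<bar>h x\<bar>" for n x by (auto simp: g_def)
    fix x assume "x \<in> {0..T}"
    have "eventually (\<lambda>n. g n x = \<bar>h x\<bar>) sequentially"
      using eventually_ge_at_top[of "nat \<lceil>\<bar>h x\<bar>\<rceil>"] 
    proof eventually_elim
      case (elim n)
      then have "\<bar>h x\<bar> \<le> real n" by linarith
      then show ?case by (simp add: g_def)
    qed
    then show "(\<lambda>n. g n x) \<longlonglongrightarrow> \<bar>h x\<bar>" by (rule tendsto_eventually)
  qed
  then have "eventually (\<lambda>n. integral {0..T} (\<lambda>x. \<bar>h x\<bar>) - e / 2 < integral {0..T} (g n)) sequentially"
    using e by (intro order_tendstoD(1)) auto
  then obtain N where N: "integral {0..T} (\<lambda>x. \<bar>h x\<bar>) - integral {0..T} (g N) < e / 2"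
    unfolding eventually_sequentially by (metis diff_less_eq add.commute order_refl)
  show "\<exists>\<delta>>0. \<forall>d S. d division_of S \<longrightarrow> S \<subseteq> {0..T} \<longrightarrow> (\<Sum>I\<in>d. Sup I - Inf I) < \<delta> \<longrightarrow>
        (\<Sum>I\<in>d. \<bar>integral {0..Sup I} h - integral {0..Inf I} h\<bar>) < e"
  proof (intro exI[of _ "e / (2 * (real N + 1))"] conjI allI impI)
    show "e / (2 * (real N + 1)) > 0" using e by simp
    fix d S assume d: "d division_of S" "S \<subseteq> {0..T}" and len: "(\<Sum>I\<in>d. Sup I - Inf I) < e / (2 * (real N + 1))"
    have incr: "\<bar>integral {0..Sup I} h - integral {0..Inf I} h\<bar> \<le>
        integral I (\<lambda>x. \<bar>h x\<bar> - g N x) + real N * (Sup I - Inf I)" if "I \<in> d" for I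
    proof -
      note I = division_of_real_interval[OF d that]
      have sub: "f integrable_on I" if "f integrable_on {0..T}" for f :: "real \<Rightarrow> real"
        using that I by (metis integrable_subinterval_real atLeastatMost_subset_iff)
      have "\<bar>integral {0..Sup I} h - integral {0..Inf I} h\<bar> = \<bar>integral I h\<bar>"
        using integral_diff_Icc[OF ih I(1-3)] I(4) by simp
      also have "\<dots> \<le> integral I (\<lambda>x. \<bar>h x\<bar>)"
        using integral_norm_bound_integral[OF sub[OF ih] sub[OF ah]] by simp
      also have "\<dots> = integral I (\<lambda>x. \<bar>h x\<bar> - g N x) + integral I (g N)"
        using sub[OF ah] sub[OF g] by (simp add: integral_diff)
      also have "integral I (g N) \<le> integral I (\<lambda>x. real N)"
        using sub[OF g] I(4) by (intro integral_le) (auto simp: g_def intro: integrable_const_ivl[of _ "Inf I" "Sup I"] sub)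
      also have "integral I (\<lambda>x. real N) = real N * (Sup I - Inf I)"
        using I by (metis integral_const_real content_real mult.commute real_scaleR_def)
      finally show ?thesis by simp
    qed
    have "(\<Sum>I\<in>d. \<bar>integral {0..Sup I} h - integral {0..Inf I} h\<bar>) \<le>
        (\<Sum>I\<in>d. integral I (\<lambda>x. \<bar>h x\<bar> - g N x)) + real N * (\<Sum>I\<in>d. Sup I - Inf I)"
      using sum_mono[of d, OF incr] by (simp add: sum.distrib sum_distrib_left)
    also have "(\<Sum>I\<in>d. integral I (\<lambda>x. \<bar>h x\<bar> - g N x)) \<le> integral {0..T} (\<lambda>x. \<bar>h x\<bar> - g N x)"
      by (rule division_integral_le[OF d]) (auto simp: g_def intro!: integrable_diff ah g[unfolded g_def])
    also have "\<dots> < e / 2" using N ah g by (simp add: integral_diff)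
    also have "real N * (\<Sum>I\<in>d. Sup I - Inf I) \<le> real N * (e / (2 * (real N + 1)))"
      using len by (intro mult_left_mono) auto
    also have "\<dots> \<le> e / 2" using e by (simp add: field_simps)
    finally show "(\<Sum>I\<in>d. \<bar>integral {0..Sup I} h - integral {0..Inf I} h\<bar>) < e" by simp
  qed
qed

section \<open>Monotonicity from a derivative that is nonnegative almost everywhere\<close>

text \<open>For u <= t <= v the errors on the two sides of t add up to \<open>e * (v - u)\<close>,
  so t need not be an endpoint. This is the form that fits a tagged division, whose tags lie
  anywhere in their intervals.\<close>

lemma nonneg_derivative_straddle:
  fixes f :: "real \<Rightarrow> real"
  assumes "(f has_real_derivative D) (at t within {0..})" "0 \<le> D" "0 \<le> t" "0 < e"
  obtains r where "r > 0" "\<And>u v. 0 \<le> u \<Longrightarrow> u \<le> t \<Longrightarrow> t \<le> v \<Longrightarrow> {u..v} \<subseteq> ball t r \<Longrightarrow> - e * (v - u) \<le> f v - f u"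
proof -
  have "(f has_derivative (\<lambda>x. D * x)) (at t within {0..})"
    using assms(1) by (simp add: has_field_derivative_def)
  then obtain r where r: "r > 0" "\<And>y. y \<in> {0..} \<Longrightarrow> norm (y - t) < r \<Longrightarrow> norm (f y - f t - D * (y - t)) \<le> e * norm (y - t)"
    unfolding has_derivative_within_alt using \<open>0 < e\<close> by blast
  show ?thesis
  proof (rule that[OF r(1)])
    fix u v assume uv: "0 \<le> u" "u \<le> t" "t \<le> v" "{u..v} \<subseteq> ball t r"
    then have "u \<in> {u..v}" "v \<in> {u..v}" by auto
    then have "u \<in> ball t r" "v \<in> ball t r" using uv(4) by blast+
    then have "\<bar>f u - f t - D * (u - t)\<bar> \<le> e * \<bar>u - t\<bar>" "\<bar>f v - f t - D * (v - t)\<bar> \<le> e * \<bar>v - t\<bar>"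
      using r(2)[of u] r(2)[of v] uv assms(3) by (auto simp: dist_real_def abs_minus_commute)
    then have "f v - f u \<ge> D * (v - u) - e * (v - u)"
      using uv by (auto simp: abs_le_iff algebra_simps)
    moreover have "D * (v - u) \<ge> 0" using assms(2) uv by simp
    ultimately show "- e * (v - u) \<le> f v - f u" by linarith
  qed
qed

lemma negligible_outer_open:
  fixes N :: "real set"
  assumes "negligible N" "0 < e"
  obtains U where "open U" "N \<subseteq> U" "U \<in> lmeasurable" "measure lebesgue U < e"
proof -
  have N: "N \<in> sets lebesgue" "N \<in> lmeasurable" "measure lebesgue N = 0"
    using assms(1) negligible_imp_sets negligible_imp_measurable negligible_imp_measure0 by auto
  obtain U where U: "open U" "N \<subseteq> U" "U - N \<in> lmeasurable" "emeasure lebesgue (U - N) < ennreal e"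
    using sets_lebesgue_outer_open[OF N(1) assms(2)] by blast
  have eq: "U = N \<union> (U - N)" using U by auto
  have "U \<in> lmeasurable" using fmeasurable.Un[OF N(2) U(3)] eq by simp
  moreover have "measure lebesgue U \<le> measure lebesgue N + measure lebesgue (U - N)"
    using N U eq by (metis measure_Un_le fmeasurableD)
  moreover have "measure lebesgue (U - N) < e"
    using U(3,4) assms(2) by (simp add: emeasure_eq_measure2 ennreal_less_iff)
  ultimately show ?thesis using that U N by auto
qed

lemma division_length_le_measure:
  fixes d :: "real set set"
  assumes d: "d division_of S" "S \<subseteq> {0..T}" and U: "\<And>I. I \<in> d \<Longrightarrow> I \<subseteq> U" "U \<in> lmeasurable"
  shows "(\<Sum>I\<in>d. Sup I - Inf I) \<le> measure lebesgue U"
proof -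
  have "(\<Sum>I\<in>d. Sup I - Inf I) = (\<Sum>I\<in>d. measure lebesgue I)"
  proof (rule sum.cong)
    fix I assume "I \<in> d"
    note I = division_of_real_interval[OF d this]
    have "measure lebesgue {Inf I..Sup I} = Sup I - Inf I" using I(2) by simp
    then show "Sup I - Inf I = measure lebesgue I" using I(4) by simp
  qed simp
  also have "\<dots> = measure lebesgue S" using content_division[OF d(1)] by simp
  also have "\<dots> \<le> measure lebesgue U"
  proof (rule measure_mono_fmeasurable)
    show "S \<subseteq> U" using U d(1) by (auto dest!: division_ofD(6))
    show "S \<in> sets lebesgue"
    proof -
      have "\<Union>d \<in> sets lebesgue"
        using division_ofD(1,4)[OF d(1)] by (intro sets.finite_Union) fastforce+
      then show ?thesis using division_ofD(6)[OF d(1)] by simp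
    qed
  qed (fact U)
  finally show ?thesis .
qed

text \<open>Cousin's lemma with a gauge that, around a tag, is controlled by the derivative where it
  exists, and by an open cover of small measure of the exceptional null set elsewhere.\<close>

lemma ac_on_mono:
  fixes f :: "real \<Rightarrow> real"
  assumes f: "ac_on T f" and N: "negligible N"
    and der: "\<And>t. a \<le> t \<Longrightarrow> t \<le> b \<Longrightarrow> t \<notin> N \<Longrightarrow>
      \<exists>D\<ge>0. (f has_real_derivative D) (at t within {0..})"
    and ab: "0 \<le> a" "a \<le> b" "b \<le> T"
  shows "f a \<le> f b"
proof -
  have le: "- e * (b - a) - e \<le> f b - f a" if e: "e > 0" for e
  proof -
    obtain \<delta> where \<delta>: "\<delta> > 0" "\<And>d S. d division_of S \<Longrightarrow> S \<subseteq> {0..T} \<Longrightarrow> (\<Sum>I\<in>d. Sup I - Inf I) < \<delta> \<Longrightarrow>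
          (\<Sum>I\<in>d. \<bar>f (Sup I) - f (Inf I)\<bar>) < e"
      using f[unfolded ac_on_def] e by blast
    obtain U where U: "open U" "N \<subseteq> U" "U \<in> lmeasurable" "measure lebesgue U < \<delta>"
      using negligible_outer_open[OF N \<delta>(1)] by blast
    have "\<exists>r>0. \<forall>u v. 0 \<le> u \<longrightarrow> u \<le> t \<longrightarrow> t \<le> v \<longrightarrow> {u..v} \<subseteq> ball t r \<longrightarrow> - e * (v - u) \<le> f v - f u"
      if "t \<in> {a..b} - N" for t
    proof -
      have t: "a \<le> t" "t \<le> b" "t \<notin> N" "0 \<le> t" using that ab by auto
      obtain D where D: "D \<ge> 0" "(f has_real_derivative D) (at t within {0..})"
        using der[OF t(1-3)] by blast
      obtain r where "r > 0"
        "\<And>u v. 0 \<le> u \<Longrightarrow> u \<le> t \<Longrightarrow> t \<le> v \<Longrightarrow> {u..v} \<subseteq> ball t r \<Longrightarrow> - e * (v - u) \<le> f v - f u"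
        using nonneg_derivative_straddle[OF D(2,1) t(4) e] by blast
      then show ?thesis by blast
    qed
    then obtain r where r: "\<And>t. t \<in> {a..b} - N \<Longrightarrow> r t > 0"
      "\<And>t u v. t \<in> {a..b} - N \<Longrightarrow> 0 \<le> u \<Longrightarrow> u \<le> t \<Longrightarrow> t \<le> v \<Longrightarrow> {u..v} \<subseteq> ball t (r t) \<Longrightarrow> - e * (v - u) \<le> f v - f u"
      by metis
    define \<gamma> where "\<gamma> t = (if t \<in> N then U else if t \<in> {a..b} then ball t (r t) else UNIV)" for t
    have "gauge \<gamma>"
      unfolding gauge_def using U r(1) by (auto simp: \<gamma>_def)
    then obtain p where p: "p tagged_division_of {a..b}" "\<gamma> fine p"
      using fine_division_exists_real by blast
    note pD = tagged_division_ofD[OF p(1)]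
    \<comment> \<open>Sums over tags and over intervals agree because \<open>w\<close> vanishes on
      intervals with empty interior, the only ones that can carry two tags. The empty set is treated
      by hand since \<open>Sup\<close> and \<open>Inf\<close> say nothing there.\<close>
    define w where "w = (\<lambda>K :: real set. if K = {} then 0 else f (Sup K) - f (Inf K))"
    define q where "q = {z \<in> p. fst z \<in> N}"
    have q: "q \<subseteq> p" "finite q" "finite (p - q)" using pD(1) by (auto simp: q_def)
    have K: "\<exists>u v. K = {u..v} \<and> u \<le> x \<and> x \<le> v \<and> a \<le> u \<and> v \<le> b" if xK: "(x, K) \<in> p" for x K
    proof -
      obtain u v where "K = cbox u v" using pD(4)[OF xK] by blast
      then show ?thesis using pD(2,3)[OF xK] by (intro exI[of _ u] exI[of _ v]) auto
    qed
    have w: "w I = f (Sup I) - f (Inf I)" if "(x, I) \<in> p" for x I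
      using K[OF that] by (auto simp: w_def)
    have qpart: "q tagged_partial_division_of {a..b}"
      using p(1) q(1) tagged_partial_division_subset by (auto simp: tagged_division_of_def)
    have qdiv: "(snd ` q) division_of \<Union>(snd ` q)"
      by (rule partial_division_of_tagged_division[OF qpart])
    have qsub: "\<Union>(snd ` q) \<subseteq> {0..T}"
      using K q(1) ab by fastforce
    have "(\<Sum>I\<in>snd ` q. Sup I - Inf I) \<le> measure lebesgue U"
    proof (rule division_length_le_measure[OF qdiv qsub _ U(3)])
      fix I assume "I \<in> snd ` q"
      then obtain x where "(x, I) \<in> p" "x \<in> N" by (auto simp: q_def)
      moreover have "I \<subseteq> \<gamma> x" using fineD[OF p(2) \<open>(x, I) \<in> p\<close>] .
      ultimately show "I \<subseteq> U" by (simp add: \<gamma>_def)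
    qed
    then have "(\<Sum>I\<in>snd ` q. \<bar>f (Sup I) - f (Inf I)\<bar>) < e"
      using \<delta>(2)[OF qdiv qsub] U(4) by linarith
    moreover have "(\<Sum>I\<in>snd ` q. \<bar>w I\<bar>) = (\<Sum>I\<in>snd ` q. \<bar>f (Sup I) - f (Inf I)\<bar>)"
      using w q(1) by (intro sum.cong) auto
    moreover have "(\<Sum>(x, K)\<in>q. \<bar>w K\<bar>) = (\<Sum>I\<in>snd ` q. \<bar>w I\<bar>)"
    proof (rule sum.over_tagged_division_lemma[OF tagged_partial_division_of_Union_self[OF qpart]])
      fix u v :: real assume "box u v = {}"
      then show "\<bar>w (cbox u v)\<bar> = 0" by (cases "u = v") (auto simp: w_def)
    qed
    ultimately have 1: "- e \<le> (\<Sum>(x, K)\<in>q. w K)"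
      using sum_abs[of "\<lambda>z. w (snd z)" q] by (auto simp: split_def)
    have "(\<Sum>(x, K)\<in>p - q. - e * (Sup K - Inf K)) \<le> (\<Sum>(x, K)\<in>p - q. w K)"
    proof (rule sum_mono, clarify)
      fix x I assume xI: "(x, I) \<in> p" "(x, I) \<notin> q"
      obtain u v where uv: "I = {u..v}" "u \<le> x" "x \<le> v" "a \<le> u" "v \<le> b" using K[OF xI(1)] by blast
      have "x \<notin> N" using xI by (auto simp: q_def)
      have "I \<subseteq> ball x (r x)"
        using fineD[OF p(2) xI(1)] \<open>x \<notin> N\<close> uv by (simp add: \<gamma>_def)
      then have "- e * (v - u) \<le> f v - f u"
        using r(2)[of x u v] uv ab \<open>x \<notin> N\<close> by auto
      then show "- e * (Sup I - Inf I) \<le> w I" using uv w[OF xI(1)] by simp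
    qed
    \<comment> \<open>Adding the tags in \<open>q\<close> only lowers the sum, all terms being
      nonpositive, and the sum over all of \<open>p\<close> telescopes.\<close>
    moreover have "(\<Sum>(x, K)\<in>p - q. - e * (Sup K - Inf K)) \<ge> (\<Sum>(x, K)\<in>p. - e * (Sup K - Inf K))"
    proof -
      have "(\<Sum>(x, K)\<in>q. - e * (Sup K - Inf K)) \<le> 0"
        using K q(1) e by (intro sum_nonpos) (fastforce simp: mult_le_0_iff)
      then show ?thesis
        using sum.subset_diff[OF q(1) pD(1), of "\<lambda>(x, K). - e * (Sup K - Inf K)"] by simp
    qed
    moreover have "(\<Sum>(x, K)\<in>p. - e * (Sup K - Inf K)) = - e * (b - a)"
      using additive_tagged_division_1[OF ab(2) p(1), of "\<lambda>x. - e * x"] by (simp add: right_diff_distrib)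
    moreover have "(\<Sum>(x, K)\<in>p. w K) = (\<Sum>(x, K)\<in>p. f (Sup K) - f (Inf K))"
      using w by (intro sum.cong) auto
    then have "(\<Sum>(x, K)\<in>p. w K) = f b - f a"
      using additive_tagged_division_1[OF ab(2) p(1), of f] by simp
    moreover have "(\<Sum>(x, K)\<in>p. w K) = (\<Sum>(x, K)\<in>p - q. w K) + (\<Sum>(x, K)\<in>q. w K)"
      using sum.subset_diff[OF q(1) pD(1)] by blast
    ultimately show ?thesis using 1 by linarith
  qed
  show ?thesis
  proof (rule field_le_epsilon)
    fix e :: real assume "e > 0"
    define d where "d = e / (b - a + 1)"
    have "b - a + 1 > 0" using ab by simp
    then have "d > 0" "d * (b - a + 1) = e" using \<open>e > 0\<close> by (simp_all add: d_def)
    then have "d > 0" "e = d * (b - a) + d" by (simp_all add: algebra_simps)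
    then show "f a \<le> f b + e" using le[of d] by simp
  qed
qed

section \<open>Lebesgue differentiation on the half-line\<close>

lemma integral_right_quotient_ae:
  fixes h :: "real \<Rightarrow> real"
  assumes "\<And>a b. h integrable_on {a..b}"
  obtains N where "negligible N"
    "\<And>x e. x \<notin> N \<Longrightarrow> 0 < e \<Longrightarrow> \<exists>d>0. \<forall>k. 0 < k \<and> k < d \<longrightarrow> \<bar>integral {x..x + k} h / k - h x\<bar> < e"
proof -
  obtain N where N: "negligible N"
    "\<And>x e. x \<notin> N \<Longrightarrow> 0 < e \<Longrightarrow> \<exists>d>0. \<forall>k. 0 < k \<and> k < d \<longrightarrow>
       norm (integral (cbox x (x + k *\<^sub>R One)) h /\<^sub>R k ^ DIM(real) - h x) < e"
    using integrable_ccontinuous_explicit[of h] assms by (metis box_real(2))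
  show ?thesis
    by (rule that[OF N(1)]) (use N(2) in \<open>simp add: divide_inverse mult.commute\<close>)
qed

text \<open>Right quotients are controlled by \<open>integral_right_quotient_ae\<close>, left
  quotients by the same fact for the reflected function, whose null set is reflected back. Extension
  by zero to \<open>g\<close> gives integrability on every bounded interval, as that fact
  requires.\<close>

lemma lebesgue_differentiation:
  fixes h :: "real \<Rightarrow> real"
  assumes h: "\<And>T. 0 \<le> T \<Longrightarrow> h integrable_on {0..T}"
  shows "AE t in lebesgue. 0 \<le> t \<longrightarrow> ((\<lambda>s. integral {0..s} h) has_real_derivative h t) (at t within {0..})"
proof -
  define g where "g = (\<lambda>t. if t \<in> {0..} then h t else 0)"
  have g: "g integrable_on {a..b}" for a b
  proof -
    have "g integrable_on {0..max 0 b}"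
      using h[of "max 0 b"] by (rule integrable_eq) (auto simp: g_def)
    then have "(\<lambda>x. if x \<in> {0..max 0 b} then g x else 0) integrable_on UNIV"
      by (subst integrable_restrict_UNIV)
    then have "(\<lambda>x. if x \<in> {0..max 0 b} then g x else 0) integrable_on {a..b}"
      by (rule integrable_on_subinterval) auto
    then show ?thesis by (rule integrable_eq) (auto simp: g_def)
  qed
  have g': "(\<lambda>x. g (- x)) integrable_on {a..b}" for a b
    using g[of "- b" "- a"] Henstock_Kurzweil_Integration.integrable_reflect_real[where f = g and a = "- b" and b = "- a"] by simp
  obtain N1 where N1: "negligible N1"
    "\<And>x e. x \<notin> N1 \<Longrightarrow> 0 < e \<Longrightarrow> \<exists>d>0. \<forall>k. 0 < k \<and> k < d \<longrightarrow> \<bar>integral {x..x + k} g / k - g x\<bar> < e"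
    using integral_right_quotient_ae[OF g] by metis
  obtain N2 where N2: "negligible N2"
    "\<And>x e. x \<notin> N2 \<Longrightarrow> 0 < e \<Longrightarrow> \<exists>d>0. \<forall>k. 0 < k \<and> k < d \<longrightarrow> \<bar>integral {x..x + k} (\<lambda>x. g (- x)) / k - g (- x)\<bar> < e"
    using integral_right_quotient_ae[OF g'] by metis
  have N2': "negligible (uminus ` N2)"
    by (rule negligible_differentiable_image_negligible[OF _ N2(1)])
       (auto intro!: differentiable_on_minus differentiable_on_id[unfolded id_def])
  have N: "negligible (N1 \<union> uminus ` N2)" using N1(1) N2' by auto
  have der: "((\<lambda>s. integral {0..s} h) has_real_derivative h t) (at t within {0..})"
    if t: "t \<notin> N1 \<union> uminus ` N2" "0 \<le> t" for t
    unfolding has_field_derivative_iff Lim_within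
  proof (intro allI impI)
    fix e :: real assume e: "0 < e"
    have "- t \<notin> N2" using t by (auto simp: image_iff)
    obtain d1 where d1: "d1 > 0" "\<And>k. 0 < k \<Longrightarrow> k < d1 \<Longrightarrow> \<bar>integral {t..t + k} g / k - g t\<bar> < e"
      using N1(2)[of t e] t e by auto
    obtain d2 where d2: "d2 > 0" "\<And>k. 0 < k \<Longrightarrow> k < d2 \<Longrightarrow> \<bar>integral {- t..- t + k} (\<lambda>x. g (- x)) / k - g t\<bar> < e"
      using N2(2)[OF \<open>- t \<notin> N2\<close> e] by auto
    have gh: "integral {u..v} g = integral {u..v} h" if "0 \<le> u" for u v
      using that by (intro integral_cong) (auto simp: g_def)
    have diff: "integral {0..v} h - integral {0..u} h = integral {u..v} h" if "0 \<le> u" "u \<le> v" for u v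
      using that h[of v] by (intro integral_diff_Icc[where T = v]) auto
    show "\<exists>d>0. \<forall>x\<in>{0..}. 0 < dist x t \<and> dist x t < d \<longrightarrow>
        dist ((integral {0..x} h - integral {0..t} h) / (x - t)) (h t) < e"
    proof (intro exI[of _ "min d1 d2"] conjI ballI impI)
      show "0 < min d1 d2" using d1 d2 by simp
      fix x assume x: "x \<in> {0..}" "0 < dist x t \<and> dist x t < min d1 d2"
      show "dist ((integral {0..x} h - integral {0..t} h) / (x - t)) (h t) < e"
      proof (cases "t < x")
        case True
        then show ?thesis
          using d1(2)[of "x - t"] x t diff[of t x] gh[of t x] by (auto simp: dist_real_def g_def)
      next
        case False
        then have lt: "x < t" using x by auto
        have "integral {- t..- x} (\<lambda>x. g (- x)) = integral {x..t} h"
          using gh[of x t] x by simp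
        moreover have "(integral {0..x} h - integral {0..t} h) / (x - t) = integral {x..t} h / (t - x)"
          using diff[of x t] x lt by (simp add: field_simps)
        ultimately show ?thesis
          using d2(2)[of "t - x"] x t lt by (auto simp: dist_real_def g_def)
      qed
    qed
  qed
  show ?thesis
    unfolding eventually_ae_filter_negligible using N der by (intro exI[of _ "N1 \<union> uminus ` N2"]) blast
qed

section \<open>Calculus of absolutely continuous functions with a prescribed derivative\<close>

text \<open>Absolute continuity and the derivative almost everywhere are kept side by side, instead
  of writing \<open>f\<close> as an integral, because both pass pointwise through products and
  exponentials. For negative \<open>T\<close> the condition \<open>ac_on T f\<close> is vacuous, so
  the quantifier over all \<open>T\<close> is harmless.\<close>

definition ac_primitive :: "(real \<Rightarrow> real) \<Rightarrow> (real \<Rightarrow> real) \<Rightarrow> bool" where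
  "ac_primitive f f' \<longleftrightarrow> (\<forall>T. ac_on T f) \<and>
     (AE t in lebesgue. 0 \<le> t \<longrightarrow> (f has_real_derivative f' t) (at t within {0..}))"

lemma ac_primitive_cong:
  assumes "ac_primitive f f'" "\<And>t. 0 \<le> t \<Longrightarrow> f' t = g' t"
  shows "ac_primitive f g'"
  using assms unfolding ac_primitive_def by (auto elim!: eventually_mono)

lemma ac_primitive_const: "ac_primitive (\<lambda>t. c) (\<lambda>t. 0)"
  unfolding ac_primitive_def by (auto intro: ac_on_const)

lemma ac_primitive_add:
  assumes "ac_primitive f f'" "ac_primitive g g'"
  shows "ac_primitive (\<lambda>t. f t + g t) (\<lambda>t. f' t + g' t)"
  unfolding ac_primitive_def
proof
  show "\<forall>T. ac_on T (\<lambda>t. f t + g t)" using assms by (auto simp: ac_primitive_def intro: ac_on_add)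
  have "AE t in lebesgue. 0 \<le> t \<longrightarrow> (f has_real_derivative f' t) (at t within {0..})"
    "AE t in lebesgue. 0 \<le> t \<longrightarrow> (g has_real_derivative g' t) (at t within {0..})"
    using assms by (auto simp: ac_primitive_def)
  then show "AE t in lebesgue. 0 \<le> t \<longrightarrow> ((\<lambda>t. f t + g t) has_real_derivative f' t + g' t) (at t within {0..})"
    by eventually_elim (auto intro: DERIV_add)
qed

lemma ac_primitive_mult:
  assumes "ac_primitive f f'" "ac_primitive g g'"
  shows "ac_primitive (\<lambda>t. f t * g t) (\<lambda>t. f' t * g t + f t * g' t)"
  unfolding ac_primitive_def
proof
  show "\<forall>T. ac_on T (\<lambda>t. f t * g t)" using assms by (auto simp: ac_primitive_def intro: ac_on_mult)
  have "AE t in lebesgue. 0 \<le> t \<longrightarrow> (f has_real_derivative f' t) (at t within {0..})"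
    "AE t in lebesgue. 0 \<le> t \<longrightarrow> (g has_real_derivative g' t) (at t within {0..})"
    using assms by (auto simp: ac_primitive_def)
  then show "AE t in lebesgue. 0 \<le> t \<longrightarrow> ((\<lambda>t. f t * g t) has_real_derivative f' t * g t + f t * g' t) (at t within {0..})"
    by eventually_elim (auto intro!: derivative_eq_intros)
qed

lemma ac_primitive_exp:
  assumes "ac_primitive f f'"
  shows "ac_primitive (\<lambda>t. exp (f t)) (\<lambda>t. f' t * exp (f t))"
  unfolding ac_primitive_def
proof
  show "\<forall>T. ac_on T (\<lambda>t. exp (f t))" using assms by (auto simp: ac_primitive_def intro: ac_on_exp)
  have "AE t in lebesgue. 0 \<le> t \<longrightarrow> (f has_real_derivative f' t) (at t within {0..})"
    using assms by (auto simp: ac_primitive_def)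
  then show "AE t in lebesgue. 0 \<le> t \<longrightarrow> ((\<lambda>t. exp (f t)) has_real_derivative f' t * exp (f t)) (at t within {0..})"
    by eventually_elim (auto intro!: derivative_eq_intros)
qed

lemma ac_primitive_cmult:
  assumes "ac_primitive f f'"
  shows "ac_primitive (\<lambda>t. c * f t) (\<lambda>t. c * f' t)"
  using ac_primitive_mult[OF ac_primitive_const[of c] assms] by simp

lemma ac_primitive_minus:
  assumes "ac_primitive f f'"
  shows "ac_primitive (\<lambda>t. - f t) (\<lambda>t. - f' t)"
  using ac_primitive_cmult[OF assms, of "- 1"] by simp

lemma ac_primitive_diff:
  assumes "ac_primitive f f'" "ac_primitive g g'"
  shows "ac_primitive (\<lambda>t. f t - g t) (\<lambda>t. f' t - g' t)"
  using ac_primitive_add[OF assms(1) ac_primitive_minus[OF assms(2)]] by simp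

lemma ac_primitive_sum:
  assumes "\<And>i. i \<in> A \<Longrightarrow> ac_primitive (f i) (f' i)"
  shows "ac_primitive (\<lambda>t. \<Sum>i\<in>A. f i t) (\<lambda>t. \<Sum>i\<in>A. f' i t)"
  using assms
  by (induction A rule: infinite_finite_induct) (auto intro: ac_primitive_const ac_primitive_add)

lemma ac_primitive_id: "ac_primitive (\<lambda>t. t) (\<lambda>t. 1)"
  unfolding ac_primitive_def ac_on_def
proof (intro conjI allI impI)
  fix T e :: real assume "e > 0"
  have "(\<Sum>I\<in>d. \<bar>Sup I - Inf I\<bar>) < e" if "d division_of S" "S \<subseteq> {0..T}" "(\<Sum>I\<in>d. Sup I - Inf I) < e" for d S
    using that(3) division_of_real_interval(2)[OF that(1,2)] by (simp cong: sum.cong)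
  then show "\<exists>\<delta>>0. \<forall>d S. d division_of S \<longrightarrow> S \<subseteq> {0..T} \<longrightarrow> (\<Sum>I\<in>d. Sup I - Inf I) < \<delta> \<longrightarrow>
        (\<Sum>I\<in>d. \<bar>Sup I - Inf I\<bar>) < e"
    using \<open>e > 0\<close> by blast
qed auto

lemma ac_primitive_integral:
  assumes "\<And>T. 0 \<le> T \<Longrightarrow> h absolutely_integrable_on {0..T}"
  shows "ac_primitive (\<lambda>t. integral {0..t} h) h"
  unfolding ac_primitive_def
proof
  show "\<forall>T. ac_on T (\<lambda>t. integral {0..t} h)"
  proof
    fix T
    have "h absolutely_integrable_on {0..T}" using assms[of T] by (cases "0 \<le> T") auto
    then show "ac_on T (\<lambda>t. integral {0..t} h)" by (rule ac_on_integral)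
  qed
  show "AE t in lebesgue. 0 \<le> t \<longrightarrow> ((\<lambda>t. integral {0..t} h) has_real_derivative h t) (at t within {0..})"
    using assms by (intro lebesgue_differentiation) (auto simp: absolutely_integrable_on_def)
qed

lemma ac_primitive_continuous: "ac_primitive f f' \<Longrightarrow> continuous_on {0..T} f"
  unfolding ac_primitive_def by (auto intro: ac_on_continuous)

lemma ac_primitive_mono:
  assumes f: "ac_primitive f f'" and nonneg: "\<And>t. a \<le> t \<Longrightarrow> t \<le> b \<Longrightarrow> 0 \<le> f' t"
    and ab: "0 \<le> a" "a \<le> b"
  shows "f a \<le> f b"
proof -
  obtain N where N: "negligible N" "{t. \<not> (0 \<le> t \<longrightarrow> (f has_real_derivative f' t) (at t within {0..}))} \<subseteq> N"
    using f unfolding ac_primitive_def eventually_ae_filter_negligible by blast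
  show ?thesis
  proof (rule ac_on_mono[OF _ N(1) _ ab order_refl])
    show "ac_on b f" using f by (simp add: ac_primitive_def)
    show "\<exists>D\<ge>0. (f has_real_derivative D) (at t within {0..})" if "a \<le> t" "t \<le> b" "t \<notin> N" for t
    proof -
      have "0 \<le> t \<longrightarrow> (f has_real_derivative f' t) (at t within {0..})" using N(2) that(3) by blast
      then have "(f has_real_derivative f' t) (at t within {0..})" using that ab by simp
      then show ?thesis using nonneg that by blast
    qed
  qed
qed

section \<open>Comparison and maximum principles\<close>

text \<open>Integrating factor: exp \<alpha> * u has derivative exp \<alpha> * (a u + u'), which the
  hypothesis makes nonnegative.\<close>

lemma exp_weighted_mono:
  assumes u: "ac_primitive u u'" and al: "ac_primitive \<alpha> a"
    and le: "\<And>t. r \<le> t \<Longrightarrow> t \<le> s \<Longrightarrow> - a t * u t \<le> u' t"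
    and rs: "0 \<le> r" "r \<le> s"
  shows "exp (\<alpha> r) * u r \<le> exp (\<alpha> s) * u s"
proof (rule ac_primitive_mono[OF ac_primitive_mult[OF ac_primitive_exp[OF al] u] _ rs])
  fix t assume "r \<le> t" "t \<le> s"
  then have "0 \<le> exp (\<alpha> t) * (a t * u t + u' t)"
    using le[of t] by (intro mult_nonneg_nonneg) auto
  then show "0 \<le> a t * exp (\<alpha> t) * u t + exp (\<alpha> t) * u' t" by (simp add: algebra_simps)
qed

text \<open>Over one period the weight exp \<alpha> grows strictly while \<open>u\<close> returns to
  its value, so monotonicity of the product leaves only one sign for \<open>u t\<close>. Periodicity
  takes the place of an initial condition.\<close>

lemma periodic_supersolution_nonneg:
  assumes u: "ac_primitive u u'" and al: "ac_primitive \<alpha> a"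
    and le: "\<And>t. 0 \<le> t \<Longrightarrow> - a t * u t \<le> u' t"
    and per: "\<And>t. 0 \<le> t \<Longrightarrow> u (t + 1) = u t"
    and inc: "\<And>t. 0 \<le> t \<Longrightarrow> \<alpha> t < \<alpha> (t + 1)"
    and t: "0 \<le> t"
  shows "0 \<le> u t"
proof -
  have "exp (\<alpha> t) * u t \<le> exp (\<alpha> (t + 1)) * u (t + 1)"
    using le t by (intro exp_weighted_mono[OF u al]) auto
  then have "0 \<le> (exp (\<alpha> (t + 1)) - exp (\<alpha> t)) * u t" using per[OF t] by (simp add: algebra_simps)
  then show ?thesis using inc[OF t] by (auto simp: zero_le_mult_iff)
qed

text \<open>The barrier \<open>y\<close> solves y' = -\<mu> (y - K) with y(r) = K', so it relaxes
  from \<open>K'\<close> to \<open>K\<close> at the pace of \<open>M\<close>. As \<open>y\<close> is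
  nonnegative, a decay rate \<open>a\<close> above \<mu> only helps, and
  \<open>exp_weighted_mono\<close> applies to \<open>g + y\<close>.\<close>

lemma relaxation_lower_bound:
  assumes g: "ac_primitive g g'" and al: "ac_primitive \<alpha> a" and M: "ac_primitive M \<mu>"
    and le: "\<And>t. r \<le> t \<Longrightarrow> t \<le> s \<Longrightarrow> - a t * g t - \<mu> t * K \<le> g' t"
    and a: "\<And>t. r \<le> t \<Longrightarrow> t \<le> s \<Longrightarrow> \<mu> t \<le> a t"
    and mono: "\<And>t. r \<le> t \<Longrightarrow> t \<le> s \<Longrightarrow> M r \<le> M t"
    and init: "- K' \<le> g r" and K: "0 \<le> K" "0 \<le> K'" and rs: "0 \<le> r" "r \<le> s"
  shows "- (K' * exp (M r - M s) + K * (1 - exp (M r - M s))) \<le> g s"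
proof -
  define y where "y = (\<lambda>t. K + (K' - K) * exp (M r - M t))"
  have y: "ac_primitive y (\<lambda>t. - \<mu> t * (y t - K))"
  proof (rule ac_primitive_cong)
    show "ac_primitive y (\<lambda>t. 0 + (K' - K) * ((0 - \<mu> t) * exp (M r - M t)))"
      unfolding y_def
      by (intro ac_primitive_add ac_primitive_const ac_primitive_cmult ac_primitive_exp ac_primitive_diff M)
  qed (simp add: y_def)
  have ynn: "0 \<le> y t" if "r \<le> t" "t \<le> s" for t
  proof -
    have "exp (M r - M t) \<le> 1" using mono[OF that] by simp
    then have "0 \<le> K * (1 - exp (M r - M t)) + K' * exp (M r - M t)"
      using K by (intro add_nonneg_nonneg mult_nonneg_nonneg) auto
    then show ?thesis by (simp add: y_def algebra_simps)
  qed
  have "exp (\<alpha> r) * (g r + y r) \<le> exp (\<alpha> s) * (g s + y s)"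
  proof (rule exp_weighted_mono[OF ac_primitive_add[OF g y] al _ rs])
    fix t assume t: "r \<le> t" "t \<le> s"
    have "0 \<le> (a t - \<mu> t) * y t" using a[OF t] ynn[OF t] by simp
    then show "- a t * (g t + y t) \<le> g' t + - \<mu> t * (y t - K)"
      using le[OF t] by (simp add: algebra_simps)
  qed
  moreover have "0 \<le> g r + y r" using init by (simp add: y_def)
  ultimately have "0 \<le> exp (\<alpha> s) * (g s + y s)" by (meson exp_ge_zero mult_nonneg_nonneg order_trans)
  then have "0 \<le> g s + y s" by (simp add: zero_le_mult_iff)
  then show ?thesis by (simp add: y_def algebra_simps)
qed

text \<open>Let the excess be the amount by which the known lower bounds fall below
  \<open>- S k\<close>; at first it is \<open>K'\<close>, uniformly in \<open>k\<close>. Feeding the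
  bound for \<open>Suc k\<close> into \<open>relaxation_lower_bound\<close> multiplies the excess by
  \<theta>, the fraction relaxed up to time \<open>T\<close>, and \<theta> < 1. Since
  \<open>S\<close> is antitone, \<open>S (Suc k)\<close> may be replaced by \<open>S k\<close> on
  the way, and letting the number of passages grow removes the excess.\<close>

lemma maximum_principle:
  fixes g :: "nat \<Rightarrow> real \<Rightarrow> real"
  assumes g: "\<And>k. ac_primitive (g k) (g' k)" and al: "\<And>k. ac_primitive (\<alpha> k) (a k)" and M: "ac_primitive M \<mu>"
    and le: "\<And>k t. 0 \<le> t \<Longrightarrow> - a k t * g k t + \<mu> t * g (Suc k) t \<le> g' k t"
    and a: "\<And>k t. 0 \<le> t \<Longrightarrow> \<mu> t \<le> a k t" and mu: "\<And>t. 0 \<le> t \<Longrightarrow> 0 \<le> \<mu> t"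
    and bounded: "\<And>k t. 0 \<le> t \<Longrightarrow> t \<le> T \<Longrightarrow> - K \<le> g k t"
    and init: "\<And>k. - S k \<le> g k 0" and S: "antimono S" "\<And>k. 0 \<le> S k"
    and t: "0 \<le> t" "t \<le> T"
  shows "- S k \<le> g k t"
proof -
  have Mmono: "M x \<le> M y" if "0 \<le> x" "x \<le> y" for x y
    using that mu by (intro ac_primitive_mono[OF M]) auto
  define \<theta> where "\<theta> = 1 - exp (M 0 - M T)"
  have th: "0 \<le> \<theta>" "\<theta> < 1" using Mmono[of 0 T] t by (auto simp: \<theta>_def)
  define K' where "K' = max K 0"
  have K': "0 \<le> K'" "K \<le> K'" by (auto simp: K'_def)
  have iter: "- (S k + K' * \<theta> ^ n) \<le> g k t" if "0 \<le> t" "t \<le> T" for n k t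
    using that
  proof (induction n arbitrary: k t)
    case 0
    then show ?case using bounded[of t k] S(2)[of k] K' by simp
  next
    case (Suc n)
    let ?c = "K' * \<theta> ^ n"
    have c: "0 \<le> ?c" using K' th by simp
    have "- (S k * exp (M 0 - M t) + (S k + ?c) * (1 - exp (M 0 - M t))) \<le> g k t"
    proof (rule relaxation_lower_bound[OF g al M])
      fix x assume x: "0 \<le> x" "x \<le> t"
      have "- (S k + ?c) \<le> g (Suc k) x"
        using Suc.IH[of x "Suc k"] x Suc.prems antimonoD[OF S(1), of k "Suc k"] by simp
      then have "\<mu> x * (- (S k + ?c)) \<le> \<mu> x * g (Suc k) x"
        using mu[OF x(1)] by (rule mult_left_mono)
      then show "- a k x * g k x - \<mu> x * (S k + ?c) \<le> g' k x"
        using le[OF x(1), of k] by (simp add: algebra_simps)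
    qed (use init S c Suc.prems a Mmono in auto)
    moreover have "S k * exp (M 0 - M t) + (S k + ?c) * (1 - exp (M 0 - M t)) = S k + ?c * (1 - exp (M 0 - M t))"
      by (simp add: algebra_simps)
    moreover have "?c * (1 - exp (M 0 - M t)) \<le> ?c * \<theta>"
      using c Mmono[of t T] Suc.prems by (intro mult_left_mono) (auto simp: \<theta>_def)
    moreover have "?c * \<theta> = K' * \<theta> ^ Suc n" by simp
    ultimately show ?case by linarith
  qed
  have "(\<lambda>n. - (S k + K' * \<theta> ^ n)) \<longlonglongrightarrow> - (S k + K' * 0)"
    using th by (intro tendsto_intros LIMSEQ_power_zero) auto
  then show ?thesis
    using iter[OF t, of k] by (intro LIMSEQ_le_const2[of "\<lambda>n. - (S k + K' * \<theta> ^ n)"]) auto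
qed

section \<open>Cumulative distribution functions of solutions\<close>

lemma ac_on_subinterval: "ac_on T f \<Longrightarrow> T' \<le> T \<Longrightarrow> ac_on T' f"
proof -
  assume f: "ac_on T f" and T: "T' \<le> T"
  have *: "S \<subseteq> {0..T}" if "S \<subseteq> {0..T'}" for S using that T by fastforce
  show "ac_on T' f" using f unfolding ac_on_def by (meson *)
qed

lemma summable_abs_diff:
  fixes x y :: "nat \<Rightarrow> real"
  assumes "summable (\<lambda>n. \<bar>x n\<bar>)" "summable (\<lambda>n. \<bar>y n\<bar>)"
  shows "summable (\<lambda>n. \<bar>x n - y n\<bar>)"
  by (rule summable_comparison_test[OF _ summable_add[OF assms]]) (auto intro!: exI[of _ 0])

lemma l1_norm_triangle_diff:
  assumes "summable (\<lambda>n. \<bar>x n\<bar>)" "summable (\<lambda>n. \<bar>y n\<bar>)"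
  shows "\<bar>l1_norm x - l1_norm y\<bar> \<le> l1_norm (\<lambda>n. x n - y n)"
proof -
  have s: "summable (\<lambda>n. \<bar>x n - y n\<bar>)"
    by (rule summable_abs_diff[OF assms])
  have "l1_norm x - l1_norm y = (\<Sum>n. \<bar>x n\<bar> - \<bar>y n\<bar>)"
    unfolding l1_norm_def using assms by (simp add: suminf_diff)
  moreover have s': "summable (\<lambda>n. \<bar>\<bar>x n\<bar> - \<bar>y n\<bar>\<bar>)"
    by (rule summable_comparison_test[OF _ s]) (auto intro!: exI[of _ 0])
  have "\<bar>\<Sum>n. \<bar>x n\<bar> - \<bar>y n\<bar>\<bar> \<le> (\<Sum>n. \<bar>\<bar>x n\<bar> - \<bar>y n\<bar>\<bar>)"
    by (rule summable_rabs[OF s'])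
  moreover have "\<dots> \<le> (\<Sum>n. \<bar>x n - y n\<bar>)"
    by (rule suminf_le[OF _ s' s]) simp
  ultimately show ?thesis by (simp add: l1_norm_def)
qed

section \<open>Batch tails, the forward operator and the equations of the partial sums\<close>

locale batch_queue =
  fixes b :: "nat \<Rightarrow> real" and lam mu :: "real \<Rightarrow> real" and L C q :: real
  assumes lam_nonneg: "\<And>t. t \<ge> 0 \<Longrightarrow> 0 \<le> lam t"
    and lam_bounded: "\<And>t. t \<ge> 0 \<Longrightarrow> lam t \<le> L"
    and lam_loc_integrable: "\<And>T. T \<ge> 0 \<Longrightarrow> lam absolutely_integrable_on {0..T}"
    and mu_nonneg: "\<And>t. t \<ge> 0 \<Longrightarrow> 0 \<le> mu t"
    and mu_loc_integrable: "\<And>T. T \<ge> 0 \<Longrightarrow> mu absolutely_integrable_on {0..T}"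
    and batch: "batch_distribution b"
    and q: "0 < q" "q < 1"
    and C: "C > 0"
    and b_geometric: "\<And>k. k \<ge> 1 \<Longrightarrow> b k \<le> C * q ^ k"
    and lam_periodic: "\<And>t. t \<ge> 0 \<Longrightarrow> lam (t + 1) = lam t"
    and mu_periodic: "\<And>t. t \<ge> 0 \<Longrightarrow> mu (t + 1) = mu t"
begin

abbreviation B :: "nat \<Rightarrow> real" where "B \<equiv> batch_tail b"
abbreviation X :: "nat set" where "X \<equiv> state_space b"
abbreviation A :: "real \<Rightarrow> (nat \<Rightarrow> real) \<Rightarrow> nat \<Rightarrow> real" where "A \<equiv> forward_operator b lam mu"

lemma b_nonneg: "0 \<le> b n" and b_0: "b 0 = 0" and b_sums: "b sums 1" and b_summable: "summable b"
  using batch by (auto simp: batch_distribution_def sums_iff)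

lemma B_eq: "B k = 1 - (\<Sum>i<k. b i)"
  using suminf_minus_initial_segment[OF b_summable, of k] b_sums by (simp add: batch_tail_def sums_iff)

lemma B_Suc: "B k = b k + B (Suc k)"
  by (simp add: B_eq)

lemma B_1: "B (Suc 0) = 1"
  by (simp add: B_eq b_0)

lemma B_nonneg: "0 \<le> B k"
  unfolding batch_tail_def using b_nonneg b_summable by (intro suminf_nonneg) (auto intro: summable_ignore_initial_segment)

lemma B_le_1: "B k \<le> 1"
  unfolding B_eq using b_nonneg by (simp add: sum_nonneg)

lemma B_geometric:
  assumes "1 \<le> k"
  shows "B k \<le> C / (1 - q) * q ^ k"
proof -
  have s: "(\<lambda>n. C * q ^ k * q ^ n) sums (C * q ^ k * (1 / (1 - q)))"
    using q by (intro sums_mult geometric_sums) auto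
  have "B k \<le> (\<Sum>n. C * q ^ k * q ^ n)"
    unfolding batch_tail_def
  proof (rule suminf_le)
    show "b (n + k) \<le> C * q ^ k * q ^ n" for n
      using b_geometric[of "n + k"] assms by (simp add: power_add mult_ac)
  qed (use b_summable s in \<open>auto intro: summable_ignore_initial_segment simp: sums_iff\<close>)
  then show ?thesis using s by (simp add: sums_iff mult_ac)
qed

lemma b_outside:
  assumes "n \<notin> X"
  shows "b n = 0"
proof (rule ccontr)
  assume "b n \<noteq> 0"
  then have "n \<in> {n. 0 < b n}" using b_nonneg[of n] by simp
  then have "n \<in> X" by (auto simp: state_space_def)
  then show False using assms by simp
qed

lemma X_downward: "n \<in> X \<Longrightarrow> m \<le> n \<Longrightarrow> m \<in> X"
  by (auto simp: state_space_def split: if_splits)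

lemma X_0: "0 \<in> X"
  by (auto simp: state_space_def)

lemma B_outside:
  assumes "k \<notin> X"
  shows "B k = 0"
proof -
  have "b (n + k) = 0" for n using assms X_downward[of "n + k" k] b_outside by auto
  then show ?thesis by (simp add: batch_tail_def)
qed

text \<open>\<open>B_1\<close> merges the diagonal entry of state 0 with the others, leaving a case
  distinction only for service. Outside the state space both sides vanish, so the formula holds for
  every \<open>j\<close>.\<close>

lemma forward_operator_eq:
  assumes x: "\<And>n. n \<notin> X \<Longrightarrow> x n = 0"
  shows "A t x j = lam t * b j * (\<Sum>i<j. x i) + mu t * x (Suc j) - lam t * B (Suc j) * x j
    - (if j = 0 then 0 else mu t * x j)"
proof (cases "j \<in> X")
  case False
  then have "Suc j \<notin> X" using X_downward[of "Suc j" j] by auto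
  then show ?thesis using False x b_outside by (simp add: forward_operator_def intensity_def)
next
  case True
  have "A t x j = (\<Sum>i\<in>{..<Suc (Suc j)}. intensity b lam mu t i j * x i)"
    unfolding forward_operator_def by (rule suminf_finite) (auto simp: intensity_def)
  also have "\<dots> = (\<Sum>i<j. intensity b lam mu t i j * x i) + intensity b lam mu t j j * x j
      + intensity b lam mu t (Suc j) j * x (Suc j)" by simp
  also have "(\<Sum>i<j. intensity b lam mu t i j * x i) = (\<Sum>i<j. lam t * b j * x i)"
    using X_downward[OF True] True by (intro sum.cong) (auto simp: intensity_def)
  also have "\<dots> = lam t * b j * (\<Sum>i<j. x i)" by (simp add: sum_distrib_left)
  also have "intensity b lam mu t (Suc j) j * x (Suc j) = mu t * x (Suc j)"
    using x[of "Suc j"] True by (auto simp: intensity_def)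
  also have "intensity b lam mu t j j * x j = - lam t * B (Suc j) * x j - (if j = 0 then 0 else mu t * x j)"
    using True B_1 by (auto simp: intensity_def algebra_simps)
  finally show ?thesis by simp
qed

text \<open>A batch of more than k customers takes the chain out of {0..k} from each of its states,
  so the outflow by arrivals depends on the partial sum alone; formally, the batch terms collapse by
  \<open>B_Suc\<close>. Service exchanges mass only across the edge between k + 1 and k.\<close>

lemma sum_forward_operator:
  assumes x: "\<And>n. n \<notin> X \<Longrightarrow> x n = 0"
  shows "(\<Sum>j<Suc k. A t x j) = - (lam t * B (Suc k) + mu t) * (\<Sum>j<Suc k. x j) + mu t * (\<Sum>j<Suc (Suc k). x j)"
proof (induction k)
  case 0
  then show ?case by (simp add: forward_operator_eq[OF x] b_0 algebra_simps)
next
  case (Suc k)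
  have "(\<Sum>j<Suc (Suc k). A t x j) = (\<Sum>j<Suc k. A t x j) + A t x (Suc k)" by simp
  also have "\<dots> = - (lam t * B (Suc k)) * (\<Sum>j<Suc k. x j) + lam t * b (Suc k) * (\<Sum>j<Suc k. x j)
      - lam t * B (Suc (Suc k)) * x (Suc k) + mu t * x (Suc (Suc k))"
    unfolding Suc by (simp add: forward_operator_eq[OF x] algebra_simps)
  also have "\<dots> = - (lam t * B (Suc (Suc k)) + mu t) * (\<Sum>j<Suc (Suc k). x j) + mu t * (\<Sum>j<Suc (Suc (Suc k)). x j)"
    unfolding B_Suc[of "Suc k"] by (simp add: algebra_simps)
  finally show ?case .
qed

lemma forward_operator_summable:
  assumes x: "l1_vector b x"
  shows "summable (\<lambda>j. \<bar>A t x j\<bar>)"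
proof (rule summable_comparison_test)
  have xs: "summable (\<lambda>n. \<bar>x n\<bar>)" and x0: "\<And>n. n \<notin> X \<Longrightarrow> x n = 0" using x by (auto simp: l1_vector_def)
  show "summable (\<lambda>j. \<bar>lam t\<bar> * l1_norm x * b j + \<bar>mu t\<bar> * \<bar>x (Suc j)\<bar> + \<bar>lam t\<bar> * \<bar>x j\<bar> + \<bar>mu t\<bar> * \<bar>x j\<bar>)"
    using xs b_summable by (intro summable_add summable_mult) (auto simp: summable_Suc_iff[of "\<lambda>n. \<bar>x n\<bar>"])
  have "norm \<bar>A t x j\<bar> \<le> \<bar>lam t\<bar> * l1_norm x * b j + \<bar>mu t\<bar> * \<bar>x (Suc j)\<bar> + \<bar>lam t\<bar> * \<bar>x j\<bar> + \<bar>mu t\<bar> * \<bar>x j\<bar>" for j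
  proof -
    have "\<bar>\<Sum>i<j. x i\<bar> \<le> (\<Sum>i<j. \<bar>x i\<bar>)" by (rule sum_abs)
    also have "\<dots> \<le> l1_norm x" unfolding l1_norm_def using xs by (intro sum_le_suminf) auto
    finally have "\<bar>lam t\<bar> * b j * \<bar>\<Sum>i<j. x i\<bar> \<le> \<bar>lam t\<bar> * b j * l1_norm x"
      using b_nonneg by (intro mult_left_mono) auto
    then have 1: "\<bar>lam t * b j * (\<Sum>i<j. x i)\<bar> \<le> \<bar>lam t\<bar> * l1_norm x * b j"
      using b_nonneg by (simp add: abs_mult mult_ac)
    have 2: "\<bar>mu t * x (Suc j)\<bar> = \<bar>mu t\<bar> * \<bar>x (Suc j)\<bar>" by (simp add: abs_mult)
    have "\<bar>lam t\<bar> * \<bar>x j\<bar> * B (Suc j) \<le> \<bar>lam t\<bar> * \<bar>x j\<bar> * 1"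
      using B_le_1 by (intro mult_left_mono) auto
    then have 3: "\<bar>lam t * B (Suc j) * x j\<bar> \<le> \<bar>lam t\<bar> * \<bar>x j\<bar>"
      using B_nonneg by (simp add: abs_mult mult_ac)
    have 4: "\<bar>if j = 0 then 0 else mu t * x j\<bar> \<le> \<bar>mu t\<bar> * \<bar>x j\<bar>" by (simp add: abs_mult)
    have "\<bar>A t x j\<bar> \<le> \<bar>lam t\<bar> * l1_norm x * b j + \<bar>mu t\<bar> * \<bar>x (Suc j)\<bar> + \<bar>lam t\<bar> * \<bar>x j\<bar> + \<bar>mu t\<bar> * \<bar>x j\<bar>"
      using 1 2 3 4 forward_operator_eq[of x t j, OF x0] by linarith
    then show ?thesis by simp
  qed
  then show "\<exists>N. \<forall>n\<ge>N. norm \<bar>A t x n\<bar> \<le> \<bar>lam t\<bar> * l1_norm x * b n + \<bar>mu t\<bar> * \<bar>x (Suc n)\<bar> + \<bar>lam t\<bar> * \<bar>x n\<bar> + \<bar>mu t\<bar> * \<bar>x n\<bar>"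
    by blast
qed

definition Mu :: "real \<Rightarrow> real" where "Mu t = integral {0..t} mu"
definition Lam :: "real \<Rightarrow> real" where "Lam t = integral {0..t} lam"
definition rate :: "nat \<Rightarrow> real \<Rightarrow> real" where "rate k t = lam t * B (Suc k) + mu t"
definition Rate :: "nat \<Rightarrow> real \<Rightarrow> real" where "Rate k t = B (Suc k) * Lam t + Mu t"

lemma Mu_primitive: "ac_primitive Mu mu" and Lam_primitive: "ac_primitive Lam lam"
  unfolding Mu_def[abs_def] Lam_def[abs_def]
  by (rule ac_primitive_integral, rule mu_loc_integrable, assumption)
     (rule ac_primitive_integral, rule lam_loc_integrable, assumption)

lemma Rate_primitive: "ac_primitive (Rate k) (rate k)"
  unfolding Rate_def[abs_def] rate_def[abs_def]
  by (rule ac_primitive_cong[OF ac_primitive_add[OF ac_primitive_cmult[OF Lam_primitive] Mu_primitive]])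
     (simp add: mult.commute)

lemma mu_le_rate: "0 \<le> t \<Longrightarrow> mu t \<le> rate k t"
  using lam_nonneg B_nonneg by (simp add: rate_def)

lemma Mu_mono: "0 \<le> s \<Longrightarrow> s \<le> t \<Longrightarrow> Mu s \<le> Mu t"
  by (rule ac_primitive_mono[OF Mu_primitive]) (auto intro: mu_nonneg)

text \<open>Partial sums are preferred to tails because their equations are homogeneous and do not
  presuppose that the total mass is one.\<close>

definition cumulative :: "(real \<Rightarrow> nat \<Rightarrow> real) \<Rightarrow> nat \<Rightarrow> real \<Rightarrow> real" where
  "cumulative p k t = (\<Sum>i<Suc k. p t i)"

context
  fixes p :: "real \<Rightarrow> nat \<Rightarrow> real"
  assumes p: "forward_solution b lam mu p"
begin

lemma solution_l1: "0 \<le> t \<Longrightarrow> l1_vector b (p t)"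
  using p by (simp add: forward_solution_def)

lemma solution_summable: "0 \<le> t \<Longrightarrow> summable (\<lambda>n. \<bar>p t n\<bar>)"
  using solution_l1 by (simp add: l1_vector_def)

lemma solution_outside: "0 \<le> t \<Longrightarrow> n \<notin> X \<Longrightarrow> p t n = 0"
  using solution_l1 by (simp add: l1_vector_def)

lemma solution_diff_summable: "0 \<le> s \<Longrightarrow> 0 \<le> t \<Longrightarrow> summable (\<lambda>n. \<bar>p s n - p t n\<bar>)"
  by (intro summable_abs_diff solution_summable)

text \<open>Coordinates and the norm of a solution are 1-Lipschitz in the l1 norm, so they inherit
  its absolute continuity.\<close>

lemma solution_ac_dominated:
  assumes le: "\<And>x y. 0 \<le> x \<Longrightarrow> x \<le> y \<Longrightarrow> \<bar>f y - f x\<bar> \<le> l1_norm (\<lambda>n. p y n - p x n)"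
  shows "ac_on T f"
proof (rule ac_on_subinterval)
  \<comment> \<open>\<open>locally_absolutely_continuous_l1\<close> speaks of positive horizons
    only.\<close>
  show "ac_on (max T 1) f"
    unfolding ac_on_def
  proof (intro allI impI)
    fix e :: real assume "e > 0"
    moreover have "max T 1 > 0" by simp
    ultimately obtain \<delta> where \<delta>: "\<delta> > 0"
      "\<And>d S. d division_of S \<Longrightarrow> S \<subseteq> {0..max T 1} \<Longrightarrow> (\<Sum>I\<in>d. Sup I - Inf I) < \<delta> \<Longrightarrow>
        (\<Sum>I\<in>d. l1_norm (\<lambda>n. p (Sup I) n - p (Inf I) n)) < e"
      using p unfolding forward_solution_def locally_absolutely_continuous_l1_def by blast
    have "(\<Sum>I\<in>d. \<bar>f (Sup I) - f (Inf I)\<bar>) < e"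
      if d: "d division_of S" "S \<subseteq> {0..max T 1}" "(\<Sum>I\<in>d. Sup I - Inf I) < \<delta>" for d S
    proof -
      have "(\<Sum>I\<in>d. \<bar>f (Sup I) - f (Inf I)\<bar>) \<le> (\<Sum>I\<in>d. l1_norm (\<lambda>n. p (Sup I) n - p (Inf I) n))"
        using division_of_real_interval[OF d(1,2)] by (intro sum_mono le)
      also have "\<dots> < e" using \<delta>(2)[OF d] .
      finally show ?thesis .
    qed
    then show "\<exists>\<delta>>0. \<forall>d S. d division_of S \<longrightarrow> S \<subseteq> {0..max T 1} \<longrightarrow> (\<Sum>I\<in>d. Sup I - Inf I) < \<delta> \<longrightarrow>
        (\<Sum>I\<in>d. \<bar>f (Sup I) - f (Inf I)\<bar>) < e"
      using \<delta>(1) by blast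
  qed
qed simp

text \<open>A coordinate is dominated by the l1 norm once the series is known to converge; for the
  error of the difference quotient this uses \<open>forward_operator_summable\<close>.\<close>

lemma solution_component_primitive: "ac_primitive (\<lambda>t. p t n) (\<lambda>t. A t (p t) n)"
  unfolding ac_primitive_def
proof
  show "\<forall>T. ac_on T (\<lambda>t. p t n)"
  proof (intro allI solution_ac_dominated)
    fix x y :: real assume "0 \<le> x" "x \<le> y"
    then have "summable (\<lambda>n. \<bar>p y n - p x n\<bar>)" by (intro solution_diff_summable) auto
    from sum_le_suminf[OF this, of "{n}"] show "\<bar>p y n - p x n\<bar> \<le> l1_norm (\<lambda>n. p y n - p x n)"
      by (simp add: l1_norm_def)
  qed
  have "AE t in lebesgue. 0 \<le> t \<longrightarrow>
        ((\<lambda>s. l1_norm (\<lambda>n. (p s n - p t n) / (s - t) - A t (p t) n)) \<longlongrightarrow> 0) (at t within {0..})"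
    using p by (simp add: forward_solution_def)
  then show "AE t in lebesgue. 0 \<le> t \<longrightarrow> ((\<lambda>t. p t n) has_real_derivative A t (p t) n) (at t within {0..})"
  proof eventually_elim
    case (elim t)
    show ?case
    proof
      assume t: "0 \<le> t"
      have "((\<lambda>s. (p s n - p t n) / (s - t) - A t (p t) n) \<longlongrightarrow> 0) (at t within {0..})"
      proof (rule Lim_null_comparison)
        show "((\<lambda>s. l1_norm (\<lambda>n. (p s n - p t n) / (s - t) - A t (p t) n)) \<longlongrightarrow> 0) (at t within {0..})"
          using elim t by simp
        show "\<forall>\<^sub>F s in at t within {0..}. norm ((p s n - p t n) / (s - t) - A t (p t) n)
            \<le> l1_norm (\<lambda>n. (p s n - p t n) / (s - t) - A t (p t) n)"
          unfolding eventually_at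
        proof (intro exI[of _ 1] conjI ballI impI)
          fix s :: real assume "s \<in> {0..}"
          then have 1: "summable (\<lambda>n. \<bar>p s n - p t n\<bar>)" using t by (intro solution_diff_summable) auto
          have "summable (\<lambda>n. \<bar>(p s n - p t n) / (s - t) - A t (p t) n\<bar>)"
          proof (rule summable_comparison_test)
            show "summable (\<lambda>n. \<bar>p s n - p t n\<bar> / \<bar>s - t\<bar> + \<bar>A t (p t) n\<bar>)"
              using 1 forward_operator_summable[OF solution_l1[OF t]] by (intro summable_add summable_divide)
            show "\<exists>N. \<forall>n\<ge>N. norm \<bar>(p s n - p t n) / (s - t) - A t (p t) n\<bar> \<le> \<bar>p s n - p t n\<bar> / \<bar>s - t\<bar> + \<bar>A t (p t) n\<bar>"
              by (metis abs_divide abs_triangle_ineq4 abs_abs real_norm_def)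
          qed
          from sum_le_suminf[OF this, of "{n}"]
          show "norm ((p s n - p t n) / (s - t) - A t (p t) n)
            \<le> l1_norm (\<lambda>n. (p s n - p t n) / (s - t) - A t (p t) n)"
            by (simp add: l1_norm_def)
        qed simp
      qed
      then show "((\<lambda>t. p t n) has_real_derivative A t (p t) n) (at t within {0..})"
        unfolding has_field_derivative_iff using Lim_null by blast
    qed
  qed
qed

lemma cumulative_primitive:
  "ac_primitive (cumulative p k) (\<lambda>t. - rate k t * cumulative p k t + mu t * cumulative p (Suc k) t)"
proof (rule ac_primitive_cong)
  show "ac_primitive (cumulative p k) (\<lambda>t. \<Sum>i<Suc k. A t (p t) i)"
    unfolding cumulative_def[abs_def] by (rule ac_primitive_sum[OF solution_component_primitive])
  show "(\<Sum>i<Suc k. A t (p t) i) = - rate k t * cumulative p k t + mu t * cumulative p (Suc k) t" if "0 \<le> t" for t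
    using sum_forward_operator[OF solution_outside[OF that]] by (simp only: rate_def cumulative_def)
qed

lemma solution_bounded:
  obtains K where "\<And>t. 0 \<le> t \<Longrightarrow> t \<le> T \<Longrightarrow> l1_norm (p t) \<le> K"
proof -
  have "ac_on T (\<lambda>t. l1_norm (p t))"
    by (rule solution_ac_dominated) (auto intro!: l1_norm_triangle_diff solution_summable)
  then show ?thesis using that ac_on_bounded by (metis abs_le_D1)
qed

text \<open>Provides the bound uniform in \<open>k\<close> from which
  \<open>maximum_principle\<close> starts.\<close>

lemma cumulative_bounded:
  obtains K where "\<And>k t. 0 \<le> t \<Longrightarrow> t \<le> T \<Longrightarrow> \<bar>cumulative p k t\<bar> \<le> K"
proof -
  obtain K where K: "\<And>t. 0 \<le> t \<Longrightarrow> t \<le> T \<Longrightarrow> l1_norm (p t) \<le> K" using solution_bounded by blast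
  have "\<bar>cumulative p k t\<bar> \<le> K" if t: "0 \<le> t" "t \<le> T" for k t
  proof -
    have "\<bar>cumulative p k t\<bar> \<le> (\<Sum>i<Suc k. \<bar>p t i\<bar>)" unfolding cumulative_def by (rule sum_abs)
    also have "\<dots> \<le> l1_norm (p t)"
      unfolding l1_norm_def using solution_summable[OF t(1)] by (intro sum_le_suminf) auto
    finally show ?thesis using K[OF t] by simp
  qed
  then show ?thesis using that by blast
qed

end

end

section \<open>The periodic tail probabilities\<close>

lemma absolutely_integrable_continuous_mult:
  fixes f g :: "real \<Rightarrow> real"
  assumes "continuous_on {0..T} f" "g absolutely_integrable_on {0..T}"
  shows "(\<lambda>x. f x * g x) absolutely_integrable_on {0..T}"
proof (rule absolutely_integrable_bounded_measurable_product_real)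
  show "f \<in> borel_measurable (lebesgue_on {0..T})"
    using assms(1) by (intro continuous_imp_measurable_on_sets_lebesgue) auto
  show "bounded (f ` {0..T})"
    using assms(1) by (intro compact_imp_bounded compact_continuous_image) auto
qed (use assms in auto)

text \<open>The factor \<rho> serves integrands such as \<open>exp (Rate k s) * c s\<close>, which
  are multiplied by \<open>exp (Rate k 1)\<close> over a period; periodic integrands are the case
  \<rho> = 1.\<close>

lemma integral_shift_scaled:
  fixes h :: "real \<Rightarrow> real"
  assumes h: "\<And>T. 0 \<le> T \<Longrightarrow> h integrable_on {0..T}"
    and per: "\<And>t. 0 \<le> t \<Longrightarrow> h (t + 1) = \<rho> * h t" and t: "0 \<le> t"
  shows "integral {0..t + 1} h = integral {0..1} h + \<rho> * integral {0..t} h"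
proof -
  have "integral {0..t + 1} h - integral {0..1} h = integral {1..t + 1} h"
    using t h[of "t + 1"] by (intro integral_diff_Icc[where T = "t + 1"]) auto
  also have "\<dots> = integral {0..t} (h \<circ> ((+) 1))"
    using integral_shift_Icc_real[of 0 t h 1] by simp
  also have "\<dots> = integral {0..t} (\<lambda>x. \<rho> * h x)"
    using per by (intro integral_cong) (auto simp: add.commute)
  also have "\<dots> = \<rho> * integral {0..t} h" by simp
  finally show ?thesis by simp
qed

lemma periodic_shift_nat:
  assumes per: "\<And>t. 0 \<le> t \<Longrightarrow> f (t + 1) = f t" and "0 \<le> (t :: real)"
  shows "f (t + real n) = f t"
proof (induction n)
  case (Suc n)
  have "f (t + real (Suc n)) = f ((t + real n) + 1)" by (simp add: algebra_simps)
  then show ?case using per[of "t + real n"] assms(2) Suc by simp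
qed simp

lemma periodic_frac:
  assumes per: "\<And>t. 0 \<le> t \<Longrightarrow> f (t + 1) = f t" and t: "0 \<le> (t :: real)"
  shows "f t = f (frac t)"
proof -
  have "t = frac t + real (nat \<lfloor>t\<rfloor>)" using t by (simp add: frac_def)
  then show ?thesis using periodic_shift_nat[of f "frac t" "nat \<lfloor>t\<rfloor>", OF per] frac_ge_0 by metis
qed

section \<open>Periodic solutions of one scalar tail equation\<close>

context batch_queue
begin

lemma lam_integrable: "0 \<le> T \<Longrightarrow> lam integrable_on {0..T}"
  and mu_integrable: "0 \<le> T \<Longrightarrow> mu integrable_on {0..T}"
  using lam_loc_integrable mu_loc_integrable by (auto simp: absolutely_integrable_on_def)

lemma Mu_shift: "0 \<le> t \<Longrightarrow> Mu (t + 1) = Mu t + Mu 1"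
  using integral_shift_scaled[OF mu_integrable, of 1 t] mu_periodic by (simp add: Mu_def)

lemma Lam_shift: "0 \<le> t \<Longrightarrow> Lam (t + 1) = Lam t + Lam 1"
  using integral_shift_scaled[OF lam_integrable, of 1 t] lam_periodic by (simp add: Lam_def)

lemma Rate_shift: "0 \<le> t \<Longrightarrow> Rate k (t + 1) = Rate k t + Rate k 1"
  by (simp only: Rate_def Mu_shift Lam_shift) (simp add: algebra_simps)

lemma Mu_0 [simp]: "Mu 0 = 0"
  by (simp add: Mu_def)

lemma L_nonneg: "0 \<le> L"
  using lam_nonneg[of 0] lam_bounded[of 0] by simp

text \<open>With the decay moved to the left, the tail equation reads T_k' + rate_k T_k =
  source_k(T_(k+1)); \<open>f\<close> stands for T_(k+1).\<close>

definition source :: "nat \<Rightarrow> (real \<Rightarrow> real) \<Rightarrow> real \<Rightarrow> real" where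
  "source k f t = lam t * B (Suc k) + mu t * f t"

definition flow_integral :: "nat \<Rightarrow> (real \<Rightarrow> real) \<Rightarrow> real \<Rightarrow> real" where
  "flow_integral k c t = integral {0..t} (\<lambda>s. exp (Rate k s) * c s)"

text \<open>Variation of constants, with the initial value for which the solution is 1-periodic.\<close>

definition flow :: "nat \<Rightarrow> (real \<Rightarrow> real) \<Rightarrow> real \<Rightarrow> real" where
  "flow k c t = exp (- Rate k t) * (flow_integral k c 1 / (exp (Rate k 1) - 1) + flow_integral k c t)"

lemma flow_primitive:
  assumes c: "\<And>T. 0 \<le> T \<Longrightarrow> (\<lambda>s. exp (Rate k s) * c s) absolutely_integrable_on {0..T}"
  shows "ac_primitive (flow k c) (\<lambda>t. c t - rate k t * flow k c t)"
proof -
  have J: "ac_primitive (flow_integral k c) (\<lambda>t. exp (Rate k t) * c t)"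
    unfolding flow_integral_def[abs_def] using c by (rule ac_primitive_integral)
  let ?K = "flow_integral k c 1 / (exp (Rate k 1) - 1)"
  have "ac_primitive (flow k c) (\<lambda>t. (- rate k t * exp (- Rate k t)) * (?K + flow_integral k c t)
      + exp (- Rate k t) * (0 + exp (Rate k t) * c t))"
    unfolding flow_def[abs_def]
    by (intro ac_primitive_mult ac_primitive_exp ac_primitive_minus Rate_primitive ac_primitive_add ac_primitive_const J)
  then show ?thesis
    by (rule ac_primitive_cong) (simp add: flow_def exp_minus algebra_simps)
qed

lemma source_integrable:
  assumes "continuous_on {0..T} f" "0 \<le> T"
  shows "source k f absolutely_integrable_on {0..T}"
proof -
  have "(\<lambda>t. B (Suc k) * lam t) absolutely_integrable_on {0..T}" "(\<lambda>t. f t * mu t) absolutely_integrable_on {0..T}"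
    using assms lam_loc_integrable mu_loc_integrable by (auto intro!: absolutely_integrable_continuous_mult)
  from set_integral_add(1)[OF this] show ?thesis by (simp add: source_def[abs_def] mult.commute)
qed

lemma exp_Rate_source_integrable:
  assumes "continuous_on {0..T} f" "0 \<le> T"
  shows "(\<lambda>s. exp (Rate k s) * source k f s) absolutely_integrable_on {0..T}"
  by (intro absolutely_integrable_continuous_mult source_integrable assms
      ac_primitive_continuous[OF ac_primitive_exp[OF Rate_primitive]])

text \<open>\<open>tail k\<close> is the probability of more than \<open>k\<close> customers, hence the shift of index in
  \<open>rate\<close> and \<open>source\<close>.\<close>

fun tail_iter :: "nat \<Rightarrow> nat \<Rightarrow> real \<Rightarrow> real" where
  "tail_iter 0 k = (\<lambda>t. 0)"
| "tail_iter (Suc n) k = flow k (source k (tail_iter n (Suc k)))"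

definition tail :: "nat \<Rightarrow> real \<Rightarrow> real" where
  "tail k t = lim (\<lambda>n. tail_iter n k t)"

end

text \<open>The added condition is the one-period form of divergence of the total service;
  \<open>nn_integral_mu_infinite_iff\<close> translates between the two.\<close>

locale active_batch_queue = batch_queue +
  assumes mu_pos: "0 < integral {0..1} mu"
begin

lemma Mu_1_pos: "0 < Mu 1"
  using mu_pos by (simp add: Mu_def)

lemma Rate_1_pos: "0 < Rate k 1"
proof -
  have "0 \<le> Lam 1"
    unfolding Lam_def using lam_nonneg lam_integrable[of 1] by (intro integral_nonneg) auto
  then have "0 \<le> B (Suc k) * Lam 1" using B_nonneg by simp
  then show ?thesis using Mu_1_pos by (simp add: Rate_def)
qed

lemma flow_periodic:
  assumes c: "\<And>T. 0 \<le> T \<Longrightarrow> (\<lambda>s. exp (Rate k s) * c s) absolutely_integrable_on {0..T}"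
    and per: "\<And>t. 0 \<le> t \<Longrightarrow> c (t + 1) = c t" and t: "0 \<le> t"
  shows "flow k c (t + 1) = flow k c t"
proof -
  let ?E = "exp (Rate k 1)" and ?J = "flow_integral k c"
  have E: "?E - 1 > 0" using Rate_1_pos by simp
  have J: "?J (t + 1) = ?J 1 + ?E * ?J t"
    unfolding flow_integral_def
    using c per t by (intro integral_shift_scaled) (auto simp: absolutely_integrable_on_def Rate_shift exp_add)
  \<comment> \<open>Fixed point equation of the period map v -> (v + J(1)) / E, which determines the
    initial value built into \<open>flow\<close>.\<close>
  have K: "?J 1 / (?E - 1) + ?J 1 = ?E * (?J 1 / (?E - 1))" using E by (simp add: field_simps)
  have "flow k c (t + 1) = exp (- Rate k t) * (exp (- Rate k 1) * (?J 1 / (?E - 1) + ?J (t + 1)))"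
    using t by (simp add: flow_def Rate_shift exp_add[symmetric])
  also have "?J 1 / (?E - 1) + ?J (t + 1) = ?E * (?J 1 / (?E - 1) + ?J t)"
    unfolding J using K by (simp add: algebra_simps)
  also have "exp (- Rate k 1) * \<dots> = ?J 1 / (?E - 1) + ?J t" by (simp add: exp_minus)
  finally show ?thesis by (simp add: flow_def)
qed

lemma flow_nonneg:
  assumes c: "\<And>T. 0 \<le> T \<Longrightarrow> (\<lambda>s. exp (Rate k s) * c s) absolutely_integrable_on {0..T}"
    and nonneg: "\<And>t. 0 \<le> t \<Longrightarrow> 0 \<le> c t" and t: "0 \<le> t"
  shows "0 \<le> flow k c t"
proof -
  have J: "0 \<le> flow_integral k c s" if "0 \<le> s" for s
    unfolding flow_integral_def using c[OF that] nonneg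
    by (intro integral_nonneg) (auto simp: absolutely_integrable_on_def)
  show ?thesis unfolding flow_def using J[of 1] J[OF t] Rate_1_pos[of k] by simp
qed

text \<open>Among periodic functions the operator f' + rate_k f is inverse monotone. Bounds and
  monotonicity of the iteration follow from this by induction on the number of steps, with
  \<open>k\<close> kept general since step n + 1 at \<open>k\<close> uses step n at
  \<open>Suc k\<close>.\<close>

lemma periodic_compare:
  assumes f: "ac_primitive f f'" "\<And>t. 0 \<le> t \<Longrightarrow> f (t + 1) = f t"
    and u: "ac_primitive u u'" "\<And>t. 0 \<le> t \<Longrightarrow> u (t + 1) = u t"
    and le: "\<And>t. 0 \<le> t \<Longrightarrow> f' t + rate k t * f t \<le> u' t + rate k t * u t"
    and t: "0 \<le> t"
  shows "f t \<le> u t"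
proof -
  have "0 \<le> u t - f t"
  proof (rule periodic_supersolution_nonneg[OF ac_primitive_diff[OF u(1) f(1)] Rate_primitive[of k] _ _ _ t])
    show "- rate k s * (u s - f s) \<le> u' s - f' s" if "0 \<le> s" for s
      using le[OF that] by (simp add: algebra_simps)
    show "Rate k s < Rate k (s + 1)" if "0 \<le> s" for s
      using Rate_shift[OF that] Rate_1_pos by simp
  qed (use f u in auto)
  then show ?thesis by simp
qed

section \<open>The monotone iteration for the tails\<close>

lemma source_periodic:
  assumes "\<And>t. 0 \<le> t \<Longrightarrow> f (t + 1) = f t" "0 \<le> t"
  shows "source k f (t + 1) = source k f t"
  using assms lam_periodic mu_periodic by (simp add: source_def)

text \<open>One induction for both properties: periodicity of the next iterate needs an integrable
  source, which continuity of the present iterate supplies.\<close>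

lemma tail_iter_regular: "(\<forall>T. continuous_on {0..T} (tail_iter n k)) \<and> (\<forall>t\<ge>0. tail_iter n k (t + 1) = tail_iter n k t)"
proof (induction n arbitrary: k)
  case (Suc n)
  then have int: "(\<lambda>s. exp (Rate k s) * source k (tail_iter n (Suc k)) s) absolutely_integrable_on {0..T}" if "0 \<le> T" for T
    using that by (intro exp_Rate_source_integrable) auto
  show ?case
    using ac_primitive_continuous[OF flow_primitive[OF int]] flow_periodic[OF int source_periodic] Suc by simp
qed auto

lemma tail_iter_continuous: "continuous_on {0..T} (tail_iter n k)"
  and tail_iter_periodic: "0 \<le> t \<Longrightarrow> tail_iter n k (t + 1) = tail_iter n k t"
  using tail_iter_regular by blast+

lemma tail_iter_primitive:
  "ac_primitive (tail_iter (Suc n) k) (\<lambda>t. source k (tail_iter n (Suc k)) t - rate k t * tail_iter (Suc n) k t)"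
  unfolding tail_iter.simps
  by (rule flow_primitive[OF exp_Rate_source_integrable]) (rule tail_iter_continuous)

lemma tail_iter_nonneg: "0 \<le> t \<Longrightarrow> 0 \<le> tail_iter n k t"
proof (induction n arbitrary: k t)
  case (Suc n)
  have "0 \<le> source k (tail_iter n (Suc k)) s" if "0 \<le> s" for s
    using Suc.IH[OF that] lam_nonneg[OF that] mu_nonneg[OF that] B_nonneg by (simp add: source_def)
  then show ?case
    using flow_nonneg[OF exp_Rate_source_integrable[OF tail_iter_continuous]] Suc.prems by simp
qed simp

text \<open>The iteration starts below \<open>u\<close> and every step preserves the order, so any
  nonnegative periodic supersolution of the whole system bounds all iterates. It is used with the
  constant 1 and with \<open>q ^ k * envelope t\<close>.\<close>

lemma tail_iter_upper:
  assumes u: "\<And>k. ac_primitive (u k) (u' k)" "\<And>k t. 0 \<le> t \<Longrightarrow> u k (t + 1) = u k t"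
    and sup: "\<And>k t. 0 \<le> t \<Longrightarrow> source k (u (Suc k)) t - rate k t * u k t \<le> u' k t"
    and nonneg: "\<And>k t. 0 \<le> t \<Longrightarrow> 0 \<le> u k t"
    and t: "0 \<le> t"
  shows "tail_iter n k t \<le> u k t"
  using t
proof (induction n arbitrary: k t)
  case (Suc n)
  show ?case
  proof (rule periodic_compare[OF tail_iter_primitive tail_iter_periodic u _ Suc.prems])
    fix t :: real assume t: "0 \<le> t"
    have "mu t * tail_iter n (Suc k) t \<le> mu t * u (Suc k) t"
      using Suc.IH[OF t] mu_nonneg[OF t] by (rule mult_left_mono)
    then show "source k (tail_iter n (Suc k)) t - rate k t * tail_iter (Suc n) k t + rate k t * tail_iter (Suc n) k t
        \<le> u' k t + rate k t * u k t"
      using sup[OF t, of k] by (simp add: source_def)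
  qed
qed (use nonneg in simp)

lemma tail_iter_le_1: "0 \<le> t \<Longrightarrow> tail_iter n k t \<le> 1"
  by (rule tail_iter_upper[where u = "\<lambda>k t. 1" and u' = "\<lambda>k t. 0"])
     (auto intro: ac_primitive_const simp: source_def rate_def)

lemma tail_iter_mono: "0 \<le> t \<Longrightarrow> tail_iter n k t \<le> tail_iter (Suc n) k t"
proof (induction n arbitrary: k t)
  case 0
  then show ?case using tail_iter_nonneg[of t "Suc 0" k] by simp
next
  case (Suc n)
  show ?case
  proof (rule periodic_compare[OF tail_iter_primitive tail_iter_periodic tail_iter_primitive tail_iter_periodic _ Suc.prems])
    fix t :: real assume t: "0 \<le> t"
    have "mu t * tail_iter n (Suc k) t \<le> mu t * tail_iter (Suc n) (Suc k) t"
      using Suc.IH[OF t] mu_nonneg[OF t] by (rule mult_left_mono)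
    then show "source k (tail_iter n (Suc k)) t - rate k t * tail_iter (Suc n) k t + rate k t * tail_iter (Suc n) k t
      \<le> source k (tail_iter (Suc n) (Suc k)) t - rate k t * tail_iter (Suc (Suc n)) k t + rate k t * tail_iter (Suc (Suc n)) k t"
      by (simp add: source_def del: tail_iter.simps)
  qed
qed

text \<open>Both functions are compared under the rate of \<open>Suc k\<close>. Relative to that
  rate the equation for \<open>k\<close> has the additional source lam b_(k+1) (1 - T_k), which is
  nonnegative because iterates are at most 1.\<close>

lemma tail_iter_antimono: "0 \<le> t \<Longrightarrow> tail_iter n (Suc k) t \<le> tail_iter n k t"
proof (induction n arbitrary: k t)
  case (Suc n)
  show ?case
  proof (rule periodic_compare[where k = "Suc k",
        OF tail_iter_primitive tail_iter_periodic tail_iter_primitive tail_iter_periodic _ Suc.prems])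
    fix t :: real assume t: "0 \<le> t"
    have 1: "mu t * tail_iter n (Suc (Suc k)) t \<le> mu t * tail_iter n (Suc k) t"
      using Suc.IH[OF t] mu_nonneg[OF t] by (rule mult_left_mono)
    have "0 \<le> lam t * b (Suc k) * (1 - tail_iter (Suc n) k t)"
      using lam_nonneg[OF t] b_nonneg tail_iter_le_1[OF t, of "Suc n" k] by (intro mult_nonneg_nonneg) auto
    then have 2: "lam t * B (Suc (Suc k)) \<le> lam t * B (Suc k) - rate k t * tail_iter (Suc n) k t
        + rate (Suc k) t * tail_iter (Suc n) k t"
      unfolding rate_def B_Suc[of "Suc k"] by (simp add: algebra_simps del: tail_iter.simps)
    show "source (Suc k) (tail_iter n (Suc (Suc k))) t - rate (Suc k) t * tail_iter (Suc n) (Suc k) t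
        + rate (Suc k) t * tail_iter (Suc n) (Suc k) t
      \<le> source k (tail_iter n (Suc k)) t - rate k t * tail_iter (Suc n) k t + rate (Suc k) t * tail_iter (Suc n) k t"
      using 1 2 by (simp add: source_def del: tail_iter.simps)
  qed
qed simp

section \<open>The geometric supersolution\<close>

text \<open>The difference is periodic, and within the first period both of its terms lie between 0
  and \<open>Mu 1\<close>.\<close>

lemma Mu_linear: "0 \<le> t \<Longrightarrow> \<bar>Mu t - Mu 1 * t\<bar> \<le> Mu 1"
proof -
  assume t: "0 \<le> t"
  have per: "Mu (s + 1) - Mu 1 * (s + 1) = Mu s - Mu 1 * s" if "0 \<le> s" for s
    using Mu_shift[OF that] by (simp add: algebra_simps)
  have "Mu t - Mu 1 * t = Mu (frac t) - Mu 1 * frac t"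
    using periodic_frac[of "\<lambda>s. Mu s - Mu 1 * s", OF per t] by simp
  moreover have "0 \<le> Mu (frac t)" "Mu (frac t) \<le> Mu 1"
    using Mu_mono[of 0 "frac t"] Mu_mono[of "frac t" 1] frac_lt_1[of t] frac_ge_0[of t] by auto
  moreover have "0 \<le> Mu 1 * frac t" "Mu 1 * frac t \<le> Mu 1 * 1"
    using Mu_1_pos frac_lt_1[of t] frac_ge_0[of t] by (auto intro!: mult_left_mono)
  ultimately show ?thesis by (intro abs_leI) linarith+
qed

text \<open>A periodic multiple of \<open>exp (- (1 - q) Mu t)\<close>; the prefactor is large enough for
  \<open>q ^ k * envelope\<close> to be a supersolution also where \<open>mu\<close> vanishes.\<close>

definition envelope :: "real \<Rightarrow> real" where
  "envelope t = exp (Mu 1) * (L * (C / (1 - q)) / ((1 - q) * Mu 1)) * exp (- (1 - q) * (Mu t - Mu 1 * t))"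

definition envelope_bound :: real where
  "envelope_bound = exp (Mu 1) * (L * (C / (1 - q)) / ((1 - q) * Mu 1)) * exp (Mu 1)"

text \<open>The exponent in \<open>envelope\<close> is at most \<open>Mu 1\<close> in absolute
  value. The prefactor exp (Mu 1) therefore keeps \<open>envelope\<close> above the ratio of the
  arrival constant L C / (1 - q) to the surplus (1 - q) Mu 1, and one more such factor bounds it
  from above.\<close>

lemma envelope_le: "0 \<le> t \<Longrightarrow> envelope t \<le> envelope_bound"
  and envelope_ge: "0 \<le> t \<Longrightarrow> L * (C / (1 - q)) / ((1 - q) * Mu 1) \<le> envelope t"
proof -
  assume t: "0 \<le> t"
  define R where "R = L * (C / (1 - q)) / ((1 - q) * Mu 1)"
  define v where "v = (1 - q) * (Mu t - Mu 1 * t)"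
  have R: "0 \<le> R" unfolding R_def using L_nonneg C q Mu_1_pos by simp
  have env: "envelope t = exp (Mu 1) * R * exp (- v)"
    by (simp only: envelope_def R_def v_def mult_minus_left)
  have "\<bar>v\<bar> \<le> 1 * Mu 1"
    unfolding v_def abs_mult using Mu_linear[OF t] q by (intro mult_mono) auto
  then have v: "v \<le> Mu 1" "- v \<le> Mu 1" by linarith+
  have "exp (- v) \<le> exp (Mu 1)" using v by simp
  then show "envelope t \<le> envelope_bound"
    unfolding env envelope_bound_def R_def[symmetric] using R by (intro mult_left_mono) auto
  have "R * 1 \<le> R * exp (Mu 1 - v)" using v R by (intro mult_left_mono) auto
  then show "L * (C / (1 - q)) / ((1 - q) * Mu 1) \<le> envelope t"
    unfolding env R_def[symmetric] by (simp add: exp_diff exp_minus field_simps)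
qed

lemma envelope_primitive: "ac_primitive envelope (\<lambda>t. - (1 - q) * (mu t - Mu 1) * envelope t)"
proof -
  let ?R = "exp (Mu 1) * (L * (C / (1 - q)) / ((1 - q) * Mu 1))"
  have "ac_primitive (\<lambda>t. ?R * exp (- (1 - q) * (Mu t - Mu 1 * t)))
     (\<lambda>t. ?R * ((- (1 - q) * (mu t - Mu 1 * 1)) * exp (- (1 - q) * (Mu t - Mu 1 * t))))"
    by (intro ac_primitive_cmult ac_primitive_exp ac_primitive_diff Mu_primitive ac_primitive_id)
  then show ?thesis
    unfolding envelope_def[abs_def] by (rule ac_primitive_cong) (simp add: mult_ac)
qed

text \<open>After the service terms cancel, the supersolution inequality reads lam B_(k+1) (1 - q^k
  e) <= (1 - q) Mu 1 q^k e, where e is \<open>envelope t\<close>. The lower bound in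
  \<open>envelope_ge\<close> is made for this, the arrivals being at most L C / (1 - q) q^k.\<close>

lemma tail_iter_geometric:
  assumes t: "0 \<le> t"
  shows "tail_iter n k t \<le> q ^ k * envelope t"
proof (rule tail_iter_upper[OF ac_primitive_cmult[OF envelope_primitive] _ _ _ t])
  fix k and t :: real assume t: "0 \<le> t"
  show "q ^ k * envelope (t + 1) = q ^ k * envelope t"
    using Mu_shift[OF t] by (simp add: envelope_def algebra_simps)
  have "0 \<le> envelope t"
    using envelope_ge[OF t] L_nonneg C q Mu_1_pos by (intro order_trans[OF _ envelope_ge[OF t]]) simp
  then show nn: "0 \<le> q ^ k * envelope t" using q by simp
  have "lam t * B (Suc k) \<le> L * (C / (1 - q) * q ^ Suc k)"
    using lam_bounded[OF t] lam_nonneg[OF t] B_nonneg B_geometric[of "Suc k"] L_nonneg by (intro mult_mono) auto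
  also have "\<dots> \<le> L * (C / (1 - q) * q ^ k)"
    using L_nonneg C q by (intro mult_left_mono) (auto simp: mult_left_le_one_le)
  also have "\<dots> = (1 - q) * Mu 1 * (q ^ k * (L * (C / (1 - q)) / ((1 - q) * Mu 1)))"
    using Mu_1_pos q by simp
  also have "\<dots> \<le> (1 - q) * Mu 1 * (q ^ k * envelope t)"
    using envelope_ge[OF t] q Mu_1_pos by (intro mult_left_mono) auto
  finally have "lam t * B (Suc k) \<le> (1 - q) * Mu 1 * (q ^ k * envelope t)" .
  moreover have "0 \<le> lam t * B (Suc k) * (q ^ k * envelope t)"
    by (rule mult_nonneg_nonneg[OF mult_nonneg_nonneg[OF lam_nonneg[OF t] B_nonneg] nn])
  ultimately show "source k (\<lambda>t. q ^ Suc k * envelope t) t - rate k t * (q ^ k * envelope t)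
      \<le> q ^ k * (- (1 - q) * (mu t - Mu 1) * envelope t)"
    by (simp add: source_def rate_def algebra_simps)
qed

section \<open>The limit of the iteration\<close>

lemma tail_iter_LIMSEQ:
  assumes "0 \<le> t"
  shows "(\<lambda>n. tail_iter n k t) \<longlonglongrightarrow> tail k t"
proof -
  have "incseq (\<lambda>n. tail_iter n k t)" using tail_iter_mono[OF assms] by (intro incseq_SucI)
  then have "convergent (\<lambda>n. tail_iter n k t)"
    using tail_iter_le_1[OF assms] by (metis convergentI incseq_convergent)
  then show ?thesis unfolding tail_def by (simp add: convergent_LIMSEQ_iff)
qed

lemma tail_periodic: "0 \<le> t \<Longrightarrow> tail k (t + 1) = tail k t"
  by (simp add: tail_def tail_iter_periodic)

lemma tail_nonneg: "0 \<le> t \<Longrightarrow> 0 \<le> tail k t"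
  using tail_iter_nonneg by (intro LIMSEQ_le_const[OF tail_iter_LIMSEQ]) auto

lemma tail_le_1: "0 \<le> t \<Longrightarrow> tail k t \<le> 1"
  using tail_iter_le_1 by (intro LIMSEQ_le_const2[OF tail_iter_LIMSEQ]) auto

lemma tail_antimono: "0 \<le> t \<Longrightarrow> tail (Suc k) t \<le> tail k t"
  using tail_iter_antimono by (intro LIMSEQ_le[OF tail_iter_LIMSEQ tail_iter_LIMSEQ]) auto

lemma tail_geometric: "0 \<le> t \<Longrightarrow> tail k t \<le> envelope_bound * q ^ k"
proof -
  assume t: "0 \<le> t"
  have "tail k t \<le> q ^ k * envelope t"
    using tail_iter_geometric[OF t] by (intro LIMSEQ_le_const2[OF tail_iter_LIMSEQ[OF t]]) auto
  also have "\<dots> \<le> q ^ k * envelope_bound" using envelope_le[OF t] q by (intro mult_left_mono) auto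
  finally show ?thesis by (simp add: mult.commute)
qed

text \<open>If k + 1 is not a state, neither is any larger number, so no batch exceeds
  \<open>k\<close> and all sources from \<open>k\<close> on vanish along the iteration.\<close>

lemma tail_outside:
  assumes "Suc k \<notin> X" "0 \<le> t"
  shows "tail k t = 0"
proof -
  have "tail_iter n k s = 0" if "0 \<le> s" "Suc k \<notin> X" for n k s
    using that
  proof (induction n arbitrary: k s)
    case (Suc n)
    have "Suc (Suc k) \<notin> X" using Suc.prems(2) X_downward[of "Suc (Suc k)" "Suc k"] by auto
    then have "source k (tail_iter n (Suc k)) x = 0" if "0 \<le> x" for x
      using Suc.IH[OF that] B_outside[OF Suc.prems(2)] by (simp add: source_def)
    then have "flow_integral k (source k (tail_iter n (Suc k))) x = 0" for x
      unfolding flow_integral_def by (intro integral_unique has_integral_is_0) auto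
    then show ?case by (simp add: flow_def)
  qed simp
  then have "(\<lambda>n. tail_iter n k t) \<longlonglongrightarrow> 0" using assms by simp
  then show ?thesis using tail_iter_LIMSEQ[OF assms(2)] LIMSEQ_unique by blast
qed

text \<open>Continuity of the pointwise limit \<open>tail\<close> is not yet available, so
  integrability of its source comes out of dominated convergence, with the source of the constant 1
  as majorant.\<close>

lemma tail_source:
  shows "0 \<le> T \<Longrightarrow> (\<lambda>s. exp (Rate k s) * source k (tail (Suc k)) s) absolutely_integrable_on {0..T}"
    and "0 \<le> T \<Longrightarrow> (\<lambda>n. flow_integral k (source k (tail_iter n (Suc k))) T) \<longlonglongrightarrow> flow_integral k (source k (tail (Suc k))) T"
proof -
  assume T: "0 \<le> T"
  let ?f = "\<lambda>n s. exp (Rate k s) * source k (tail_iter n (Suc k)) s"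
  let ?g = "\<lambda>s. exp (Rate k s) * source k (tail (Suc k)) s"
  let ?h = "\<lambda>s. exp (Rate k s) * source k (\<lambda>s. 1) s"
  have f: "?f n integrable_on {0..T}" for n
    using exp_Rate_source_integrable[OF tail_iter_continuous T] by (simp add: absolutely_integrable_on_def)
  have h: "?h integrable_on {0..T}"
    using exp_Rate_source_integrable[OF continuous_on_const T] by (simp add: absolutely_integrable_on_def)
  have le: "norm (?f n s) \<le> ?h s" if "s \<in> {0..T}" for n s
  proof -
    have s: "0 \<le> s" using that by simp
    have "0 \<le> source k (tail_iter n (Suc k)) s" "source k (tail_iter n (Suc k)) s \<le> source k (\<lambda>s. 1) s"
      using lam_nonneg[OF s] mu_nonneg[OF s] B_nonneg[of "Suc k"] tail_iter_nonneg[OF s] tail_iter_le_1[OF s]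
      by (auto simp: source_def mult_left_le)
    then show ?thesis by simp
  qed
  have lim: "(\<lambda>n. ?f n s) \<longlonglongrightarrow> ?g s" if "s \<in> {0..T}" for s
    unfolding source_def using tail_iter_LIMSEQ[of s] that by (intro tendsto_intros) auto
  have g: "?g integrable_on {0..T}" by (rule dominated_convergence(1)[OF f h le lim])
  have "0 \<le> ?g s" if "s \<in> {0..T}" for s
    using that lam_nonneg[of s] mu_nonneg[of s] B_nonneg tail_nonneg by (simp add: source_def)
  then show "?g absolutely_integrable_on {0..T}" by (intro nonnegative_absolutely_integrable_1 g)
  show "(\<lambda>n. flow_integral k (source k (tail_iter n (Suc k))) T) \<longlonglongrightarrow> flow_integral k (source k (tail (Suc k))) T"
    unfolding flow_integral_def by (rule dominated_convergence(2)[OF f h le lim])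
qed

text \<open>The limit of the recursion is an integral equation for \<open>tail\<close>, which
  restores the regularity that a pointwise limit could have lost.\<close>

lemma tail_flow:
  assumes t: "0 \<le> t"
  shows "tail k t = flow k (source k (tail (Suc k))) t"
proof -
  have "(\<lambda>n. tail_iter (Suc n) k t) \<longlonglongrightarrow> flow k (source k (tail (Suc k))) t"
    unfolding tail_iter.simps flow_def using t Rate_1_pos[of k] by (intro tendsto_intros tail_source) auto
  moreover have "(\<lambda>n. tail_iter (Suc n) k t) \<longlonglongrightarrow> tail k t"
    using tail_iter_LIMSEQ[OF t] by (rule LIMSEQ_Suc)
  ultimately show ?thesis using LIMSEQ_unique by blast
qed

end

lemma ac_primitive_transform:
  assumes f: "ac_primitive f f'" and eq: "\<And>t. 0 \<le> t \<Longrightarrow> g t = f t"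
  shows "ac_primitive g f'"
  unfolding ac_primitive_def
proof
  show "\<forall>T. ac_on T g"
  proof
    fix T
    have "ac_on T f" using f by (simp add: ac_primitive_def)
    then show "ac_on T g"
      by (rule ac_on_dominated[where h = f and K = 1]) (use f eq in \<open>auto simp: ac_primitive_def\<close>)
  qed
  have "AE t in lebesgue. 0 \<le> t \<longrightarrow> (f has_real_derivative f' t) (at t within {0..})"
    using f by (simp add: ac_primitive_def)
  then show "AE t in lebesgue. 0 \<le> t \<longrightarrow> (g has_real_derivative f' t) (at t within {0..})"
  proof eventually_elim
    case (elim t)
    then show ?case
      unfolding has_field_derivative_def by (auto intro: has_derivative_transform[where f = f] eq)
  qed
qed

section \<open>The periodic distribution as a solution in the l1 norm\<close>

context active_batch_queue
begin

lemma tail_primitive: "ac_primitive (tail k) (\<lambda>t. source k (tail (Suc k)) t - rate k t * tail k t)"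
proof (rule ac_primitive_cong)
  show "ac_primitive (tail k) (\<lambda>t. source k (tail (Suc k)) t - rate k t * flow k (source k (tail (Suc k))) t)"
    by (rule ac_primitive_transform[OF flow_primitive[OF tail_source(1)] tail_flow])
qed (simp add: tail_flow[symmetric])

definition stationary :: "real \<Rightarrow> nat \<Rightarrow> real" where
  "stationary t n = (case n of 0 \<Rightarrow> 1 - tail 0 t | Suc k \<Rightarrow> tail k t - tail (Suc k) t)"

lemma cumulative_stationary: "cumulative stationary k t = 1 - tail k t"
  unfolding cumulative_def by (induction k) (auto simp: stationary_def)

lemma tail_tendsto_0:
  assumes "0 \<le> t"
  shows "(\<lambda>k. tail k t) \<longlonglongrightarrow> 0"
proof (rule tendsto_sandwich[where f = "\<lambda>k. 0" and h = "\<lambda>k. envelope_bound * q ^ k"])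
  show "(\<lambda>k. envelope_bound * q ^ k) \<longlonglongrightarrow> 0"
    using q by (intro tendsto_mult_right_zero LIMSEQ_power_zero) auto
  show "\<forall>\<^sub>F k in sequentially. 0 \<le> tail k t" using tail_nonneg[OF assms] by simp
  show "\<forall>\<^sub>F k in sequentially. tail k t \<le> envelope_bound * q ^ k" using tail_geometric[OF assms] by simp
qed simp

lemma sums_iff_cumulative: "p t sums s \<longleftrightarrow> (\<lambda>k. cumulative p k t) \<longlonglongrightarrow> s"
  unfolding sums_def cumulative_def by (rule filterlim_sequentially_Suc[symmetric])

lemma stationary_outside: "0 \<le> t \<Longrightarrow> n \<notin> X \<Longrightarrow> stationary t n = 0"
  using X_0 X_downward[of "Suc n" n] by (cases n) (auto simp: stationary_def tail_outside intro!: tail_outside)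

lemma stationary_probability: "0 \<le> t \<Longrightarrow> probability_vector b (stationary t)"
  unfolding probability_vector_def sums_iff_cumulative cumulative_stationary
proof (intro conjI allI impI)
  assume t: "0 \<le> t"
  show "stationary t n = 0" if "n \<notin> X" for n using stationary_outside[OF t that] .
  show "0 \<le> stationary t n" for n
    using tail_le_1[OF t] tail_antimono[OF t] by (auto simp: stationary_def split: nat.splits)
  show "(\<lambda>k. 1 - tail k t) \<longlonglongrightarrow> 1" using tendsto_diff[OF tendsto_const tail_tendsto_0[OF t], of 1] by simp
qed

lemma stationary_periodic: "0 \<le> t \<Longrightarrow> stationary (t + 1) = stationary t"
  by (auto simp: stationary_def tail_periodic fun_eq_iff split: nat.splits)

lemma cumulative_stationary_primitive:
  "ac_primitive (cumulative stationary k)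
     (\<lambda>t. - rate k t * cumulative stationary k t + mu t * cumulative stationary (Suc k) t)"
  unfolding cumulative_stationary
  by (rule ac_primitive_cong[OF ac_primitive_diff[OF ac_primitive_const tail_primitive]])
     (simp add: source_def rate_def algebra_simps)

lemma stationary_component_primitive: "ac_primitive (\<lambda>t. stationary t n) (\<lambda>t. A t (stationary t) n)"
proof -
  have sum: "ac_primitive (cumulative stationary k) (\<lambda>t. \<Sum>j<Suc k. A t (stationary t) j)" for k
    by (rule ac_primitive_cong[OF cumulative_stationary_primitive])
       (subst sum_forward_operator, rule stationary_outside, auto simp: cumulative_def rate_def)
  show ?thesis
  proof (cases n)
    case 0
    then show ?thesis using sum[of 0] by (simp add: cumulative_def[abs_def])
  next
    case (Suc k)
    have "ac_primitive (\<lambda>t. cumulative stationary (Suc k) t - cumulative stationary k t)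
       (\<lambda>t. (\<Sum>j<Suc (Suc k). A t (stationary t) j) - (\<Sum>j<Suc k. A t (stationary t) j))"
      by (rule ac_primitive_diff[OF sum sum])
    then show ?thesis by (simp add: Suc cumulative_def[abs_def])
  qed
qed

text \<open>A time scale in which all tails are Lipschitz simultaneously, with constants decaying
  like q^k. In ordinary time this may fail, since \<open>mu\<close> may be unbounded.\<close>

definition clock :: "real \<Rightarrow> real" where
  "clock t = Lam t + Mu t"

definition modulus :: real where
  "modulus = C / (1 - q) + envelope_bound"

lemma clock_primitive: "ac_primitive clock (\<lambda>t. lam t + mu t)"
  unfolding clock_def[abs_def] by (intro ac_primitive_add Lam_primitive Mu_primitive)

text \<open>Arrivals raise the tail at a rate of at most lam C / (1 - q) q^k, service lowers it at a
  rate of at most mu times \<open>envelope_bound * q ^ k\<close>; \<open>modulus\<close> adds the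
  two constants.\<close>

lemma tail_derivative_bound:
  assumes t: "0 \<le> t"
  shows "\<bar>source k (tail (Suc k)) t - rate k t * tail k t\<bar> \<le> modulus * q ^ k * (lam t + mu t)"
proof -
  have "C / (1 - q) * q ^ Suc k \<le> C / (1 - q) * q ^ k"
    using C q by (intro mult_left_mono) (auto simp: mult_left_le_one_le)
  then have B: "B (Suc k) \<le> C / (1 - q) * q ^ k" using B_geometric[of "Suc k"] by simp
  have "0 \<le> 1 - tail k t" "1 - tail k t \<le> 1" using tail_le_1[OF t] tail_nonneg[OF t] by auto
  then have 1: "0 \<le> lam t * B (Suc k) * (1 - tail k t)" "lam t * B (Suc k) * (1 - tail k t) \<le> lam t * (C / (1 - q) * q ^ k) * 1"
    using lam_nonneg[OF t] B_nonneg[of "Suc k"] B C q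
    by (auto intro!: mult_mono mult_nonneg_nonneg divide_nonneg_nonneg
        simp del: mult_1_right times_divide_eq_left times_divide_eq_right)
  have 2: "0 \<le> mu t * (tail k t - tail (Suc k) t)" "mu t * (tail k t - tail (Suc k) t) \<le> mu t * (envelope_bound * q ^ k)"
    using mu_nonneg[OF t] tail_antimono[OF t, of k] tail_geometric[OF t, of k] tail_nonneg[OF t, of "Suc k"]
    by (auto intro!: mult_left_mono mult_nonneg_nonneg)
  have 3: "0 \<le> lam t * (C / (1 - q) * q ^ k)" "0 \<le> mu t * (C / (1 - q) * q ^ k)"
    using lam_nonneg[OF t] mu_nonneg[OF t] C q by auto
  have "0 \<le> envelope_bound * q ^ k" using tail_nonneg[OF t] tail_geometric[OF t] order_trans by blast
  then have 4: "0 \<le> lam t * (envelope_bound * q ^ k)" "0 \<le> mu t * (envelope_bound * q ^ k)"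
    using lam_nonneg[OF t] mu_nonneg[OF t] by auto
  have "source k (tail (Suc k)) t - rate k t * tail k t
     = lam t * B (Suc k) * (1 - tail k t) - mu t * (tail k t - tail (Suc k) t)"
    by (simp add: source_def rate_def algebra_simps)
  moreover have "modulus * q ^ k * (lam t + mu t) = lam t * (C / (1 - q) * q ^ k) + mu t * (C / (1 - q) * q ^ k)
      + lam t * (envelope_bound * q ^ k) + mu t * (envelope_bound * q ^ k)"
    by (simp add: modulus_def distrib_left distrib_right mult_ac add_divide_distrib)
  ultimately show ?thesis using 1 2 3 4 by (intro abs_leI) linarith+
qed

lemma tail_lipschitz:
  assumes st: "0 \<le> s" "s \<le> t"
  shows "\<bar>tail k t - tail k s\<bar> \<le> modulus * q ^ k * (clock t - clock s)"
proof -
  let ?c = "modulus * q ^ k" and ?d = "\<lambda>x. source k (tail (Suc k)) x - rate k x * tail k x"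
  have d: "0 \<le> ?c * (lam x + mu x) + ?d x" "0 \<le> ?c * (lam x + mu x) - ?d x" if "s \<le> x" for x
    using tail_derivative_bound[of x k] st that by linarith+
  have "?c * clock s + tail k s \<le> ?c * clock t + tail k t"
    by (rule ac_primitive_mono[OF ac_primitive_add[OF ac_primitive_cmult[OF clock_primitive] tail_primitive] d(1) st])
  moreover have "?c * clock s - tail k s \<le> ?c * clock t - tail k t"
    by (rule ac_primitive_mono[OF ac_primitive_diff[OF ac_primitive_cmult[OF clock_primitive] tail_primitive] d(2) st])
  ultimately show ?thesis by (simp add: abs_le_iff algebra_simps)
qed

lemma modulus_nonneg: "0 \<le> modulus"
proof -
  have "0 \<le> envelope_bound * q ^ 0" using tail_nonneg[of 0 0] tail_geometric[of 0 0] order_trans by blast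
  then show ?thesis using C q by (simp add: modulus_def)
qed

text \<open>State n involves the tails n - 1 and n; the lower index costs the factor 1 / q.\<close>

lemma stationary_lipschitz:
  assumes st: "0 \<le> s" "s \<le> t"
  shows "\<bar>stationary t n - stationary s n\<bar> \<le> (modulus + modulus / q) * q ^ n * (clock t - clock s)"
proof (cases n)
  case 0
  have "0 \<le> modulus / q * (clock t - clock s)"
    using modulus_nonneg q st ac_primitive_mono[OF clock_primitive _ st] lam_nonneg mu_nonneg by simp
  then show ?thesis
    using tail_lipschitz[OF st, of 0] 0 by (simp add: stationary_def distrib_right abs_minus_commute)
next
  case (Suc k)
  have "(modulus + modulus / q) * q ^ n * (clock t - clock s)
     = modulus * q ^ k * (clock t - clock s) + modulus * q ^ Suc k * (clock t - clock s)"
    using q Suc by (simp add: field_simps)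
  then show ?thesis
    using tail_lipschitz[OF st, of k] tail_lipschitz[OF st, of "Suc k"] Suc by (simp add: stationary_def)
qed

lemma summable_modulus: "summable (\<lambda>n. (modulus + modulus / q) * q ^ n)"
  using q by (intro summable_mult summable_geometric) auto

lemma stationary_quotient_bound:
  assumes st: "0 \<le> s" "0 \<le> t"
  shows "\<bar>(stationary s n - stationary t n) / (s - t)\<bar> \<le> (modulus + modulus / q) * q ^ n * \<bar>(clock s - clock t) / (s - t)\<bar>"
proof -
  have "\<bar>stationary s n - stationary t n\<bar> \<le> (modulus + modulus / q) * q ^ n * \<bar>clock s - clock t\<bar>"
  proof (cases "s \<le> t")
    case True
    have "clock s \<le> clock t"
      using ac_primitive_mono[OF clock_primitive _ st(1) True] lam_nonneg mu_nonneg st by simp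
    then show ?thesis using stationary_lipschitz[OF st(1) True, of n] by (simp add: abs_minus_commute)
  next
    case False
    then have "clock t \<le> clock s"
      using ac_primitive_mono[OF clock_primitive _ st(2)] lam_nonneg mu_nonneg st by simp
    then show ?thesis using stationary_lipschitz[OF st(2), of s n] False by simp
  qed
  then have "\<bar>stationary s n - stationary t n\<bar> / \<bar>s - t\<bar> \<le> (modulus + modulus / q) * q ^ n * \<bar>clock s - clock t\<bar> / \<bar>s - t\<bar>"
    by (intro divide_right_mono) auto
  then show ?thesis by (simp add: abs_divide)
qed

text \<open>The exceptional null sets of the countably many coordinates and of \<open>clock\<close>
  are merged into one. Off it every coordinate has its derivative, and the quotients are dominated
  by a summable weight times the quotient of \<open>clock\<close>, so Tannery's theorem exchanges
  the limit with the sum.\<close>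

lemma stationary_solution: "forward_solution b lam mu stationary"
  unfolding forward_solution_def
proof (intro conjI allI impI)
  show "l1_vector b (stationary t)" if "0 \<le> t" for t
    using stationary_probability[OF that] by (auto simp: l1_vector_def probability_vector_def sums_iff)
  let ?w = "\<lambda>n. (modulus + modulus / q) * q ^ n"
  define W where "W = suminf ?w"
  have w: "0 \<le> ?w n" for n using modulus_nonneg q by simp
  have W: "0 \<le> W" unfolding W_def using w by (intro suminf_nonneg summable_modulus) auto
  have l1: "l1_norm (\<lambda>n. stationary t n - stationary s n) \<le> W * (clock t - clock s)" if st: "0 \<le> s" "s \<le> t" for s t
    unfolding l1_norm_def W_def suminf_mult2[OF summable_modulus]
  proof (rule suminf_le)
    show sw: "summable (\<lambda>n. ?w n * (clock t - clock s))" by (intro summable_mult2 summable_modulus)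
    show le: "\<bar>stationary t n - stationary s n\<bar> \<le> ?w n * (clock t - clock s)" for n
      by (rule stationary_lipschitz[OF st])
    show "summable (\<lambda>n. \<bar>stationary t n - stationary s n\<bar>)"
      by (rule summable_comparison_test[OF _ sw]) (use le in auto)
  qed
  show "locally_absolutely_continuous_l1 stationary"
    unfolding locally_absolutely_continuous_l1_def
  proof (intro allI impI)
    fix T e :: real assume "0 < T" "0 < e"
    then have "0 < e / (W + 1)" using W by simp
    moreover have "ac_on T clock" using clock_primitive by (simp add: ac_primitive_def)
    ultimately obtain \<delta> where \<delta>: "\<delta> > 0" "\<And>d S. d division_of S \<Longrightarrow> S \<subseteq> {0..T} \<Longrightarrow> (\<Sum>I\<in>d. Sup I - Inf I) < \<delta> \<Longrightarrow>
        (\<Sum>I\<in>d. \<bar>clock (Sup I) - clock (Inf I)\<bar>) < e / (W + 1)"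
      unfolding ac_on_def by blast
    have "(\<Sum>I\<in>d. l1_norm (\<lambda>n. stationary (Sup I) n - stationary (Inf I) n)) < e"
      if d: "d division_of S" "S \<subseteq> {0..T}" "(\<Sum>I\<in>d. Sup I - Inf I) < \<delta>" for d S
    proof -
      have "(\<Sum>I\<in>d. l1_norm (\<lambda>n. stationary (Sup I) n - stationary (Inf I) n)) \<le> (\<Sum>I\<in>d. (W + 1) * \<bar>clock (Sup I) - clock (Inf I)\<bar>)"
      proof (rule sum_mono)
        fix I assume "I \<in> d"
        note I = division_of_real_interval[OF d(1,2) this]
        have "W * (clock (Sup I) - clock (Inf I)) \<le> W * \<bar>clock (Sup I) - clock (Inf I)\<bar>"
          using W by (intro mult_left_mono) auto
        also have "\<dots> \<le> (W + 1) * \<bar>clock (Sup I) - clock (Inf I)\<bar>"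
          by (intro mult_right_mono) auto
        finally have "W * (clock (Sup I) - clock (Inf I)) \<le> (W + 1) * \<bar>clock (Sup I) - clock (Inf I)\<bar>" .
        then show "l1_norm (\<lambda>n. stationary (Sup I) n - stationary (Inf I) n) \<le> (W + 1) * \<bar>clock (Sup I) - clock (Inf I)\<bar>"
          using l1[OF I(1,2)] by linarith
      qed
      also have "\<dots> = (W + 1) * (\<Sum>I\<in>d. \<bar>clock (Sup I) - clock (Inf I)\<bar>)" by (simp add: sum_distrib_left)
      also have "\<dots> < (W + 1) * (e / (W + 1))" using W \<delta>(2)[OF d] by (intro mult_strict_left_mono) auto
      also have "\<dots> = e" using W by simp
      finally show ?thesis .
    qed
    then show "\<exists>\<delta>>0. \<forall>d S. d division_of S \<longrightarrow> S \<subseteq> {0..T} \<longrightarrow> (\<Sum>I\<in>d. Sup I - Inf I) < \<delta> \<longrightarrow>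
        (\<Sum>I\<in>d. l1_norm (\<lambda>n. stationary (Sup I) n - stationary (Inf I) n)) < e"
      using \<delta>(1) by blast
  qed
  have "AE t in lebesgue. \<forall>n. 0 \<le> t \<longrightarrow> ((\<lambda>s. stationary s n) has_real_derivative A t (stationary t) n) (at t within {0..})"
    unfolding AE_all_countable using stationary_component_primitive by (simp add: ac_primitive_def)
  moreover have "AE t in lebesgue. 0 \<le> t \<longrightarrow> (clock has_real_derivative lam t + mu t) (at t within {0..})"
    using clock_primitive by (simp add: ac_primitive_def)
  ultimately show "AE t in lebesgue. 0 \<le> t \<longrightarrow>
      ((\<lambda>s. l1_norm (\<lambda>n. (stationary s n - stationary t n) / (s - t) - A t (stationary t) n)) \<longlongrightarrow> 0) (at t within {0..})"
  proof eventually_elim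
    case (elim t)
    show ?case
    proof
      assume t: "0 \<le> t"
      let ?F = "at t within {0..}"
      have lim: "((\<lambda>s. (stationary s n - stationary t n) / (s - t)) \<longlongrightarrow> A t (stationary t) n) ?F" for n
        using elim(1) t by (simp add: has_field_derivative_iff)
      have clk: "((\<lambda>s. \<bar>(clock s - clock t) / (s - t)\<bar>) \<longlongrightarrow> \<bar>lam t + mu t\<bar>) ?F"
        using elim(2) t by (intro tendsto_rabs) (simp add: has_field_derivative_iff)
      \<comment> \<open>Strictly above the limit of the quotients of \<open>clock\<close>, hence a
        bound for them near \<open>t\<close>.\<close>
      define \<theta> where "\<theta> = \<bar>lam t + mu t\<bar> + 1"
      have nn: "eventually (\<lambda>s. 0 \<le> s) ?F" by (auto simp: eventually_at intro: exI[of _ 1])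
      have ev: "eventually (\<lambda>s. \<forall>n. \<bar>(stationary s n - stationary t n) / (s - t)\<bar> \<le> ?w n * \<theta>) ?F"
        using order_tendstoD(2)[OF clk, of \<theta>, unfolded \<theta>_def, simplified] nn
      proof eventually_elim
        case (elim s)
        have "?w n * \<bar>(clock s - clock t) / (s - t)\<bar> \<le> ?w n * \<theta>" for n
          using elim(1) w[of n] by (intro mult_left_mono) (auto simp: \<theta>_def)
        then show ?case using stationary_quotient_bound[OF elim(2) t] order_trans by blast
      qed
      \<comment> \<open>The bound on the quotients passes to the limit only along a proper filter;
        approach from the right is available even at \<open>t = 0\<close>.\<close>
      have "at_right t \<le> ?F" using t by (intro at_le) auto
      then have F: "?F \<noteq> bot" using trivial_limit_at_right_real[of t] by (metis bot.extremum_uniqueI)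
      have A: "\<bar>A t (stationary t) n\<bar> \<le> ?w n * \<theta>" for n
        by (rule tendsto_upperbound[OF tendsto_rabs[OF lim] _ F]) (use ev in \<open>auto elim: eventually_mono\<close>)
      have "((\<lambda>s. \<Sum>n. \<bar>(stationary s n - stationary t n) / (s - t) - A t (stationary t) n\<bar>) \<longlongrightarrow> (\<Sum>n. 0)) ?F"
      proof (rule tannerys_theorem[THEN conjunct2, THEN conjunct2, OF _ _ _ F])
        show "((\<lambda>s. \<bar>(stationary s n - stationary t n) / (s - t) - A t (stationary t) n\<bar>) \<longlongrightarrow> 0) ?F" for n
          using tendsto_rabs[OF tendsto_diff[OF lim[of n] tendsto_const[of "A t (stationary t) n"]]] by simp
        have "eventually (\<lambda>s. \<forall>n. norm \<bar>(stationary s n - stationary t n) / (s - t) - A t (stationary t) n\<bar> \<le> 2 * (?w n * \<theta>)) ?F"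
          using ev
        proof eventually_elim
          case (elim s)
          show ?case
          proof
            fix n
            have "\<bar>(stationary s n - stationary t n) / (s - t) - A t (stationary t) n\<bar>
                \<le> \<bar>(stationary s n - stationary t n) / (s - t)\<bar> + \<bar>A t (stationary t) n\<bar>" by (rule abs_triangle_ineq4)
            also have "\<dots> \<le> ?w n * \<theta> + ?w n * \<theta>" using elim A by (intro add_mono) auto
            finally show "norm \<bar>(stationary s n - stationary t n) / (s - t) - A t (stationary t) n\<bar> \<le> 2 * (?w n * \<theta>)"
              by (simp only: real_norm_def abs_abs mult_2)
          qed
        qed
        then show "\<forall>\<^sub>F (n, s) in sequentially \<times>\<^sub>F ?F.
            norm \<bar>(stationary s n - stationary t n) / (s - t) - A t (stationary t) n\<bar> \<le> 2 * (?w n * \<theta>)"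
          unfolding eventually_prod_filter by (intro exI[of _ "\<lambda>_. True"] exI) auto
        show "summable (\<lambda>n. 2 * (?w n * \<theta>))" by (intro summable_mult summable_mult2 summable_modulus)
      qed
      then show "((\<lambda>s. l1_norm (\<lambda>n. (stationary s n - stationary t n) / (s - t) - A t (stationary t) n)) \<longlongrightarrow> 0) ?F"
        by (simp add: l1_norm_def)
    qed
  qed
qed

end

section \<open>Convergence of distributions and means\<close>

text \<open>Both vectors have total mass one, so the mass of \<open>x\<close> beyond \<open>N\<close> is controlled by that of \<open>y\<close>.\<close>

lemma l1_norm_diff_le:
  assumes x: "\<And>n. 0 \<le> x n" "x sums 1" and y: "\<And>n. 0 \<le> y n" "y sums (1::real)"
  shows "l1_norm (\<lambda>n. x n - y n) \<le> 2 * (\<Sum>n<N. \<bar>x n - y n\<bar>) + 2 * (1 - (\<Sum>n<N. y n))"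
proof -
  have xs: "summable x" "summable y" using x y by (auto simp: sums_iff)
  have s: "summable (\<lambda>n. \<bar>x n - y n\<bar>)"
    using x y xs by (intro summable_abs_diff) auto
  have xN: "summable (\<lambda>n. x (n + N))" "summable (\<lambda>n. y (n + N))" using xs by (auto intro: summable_ignore_initial_segment)
  have "l1_norm (\<lambda>n. x n - y n) = (\<Sum>n. \<bar>x (n + N) - y (n + N)\<bar>) + (\<Sum>n<N. \<bar>x n - y n\<bar>)"
    unfolding l1_norm_def by (rule suminf_split_initial_segment[OF s])
  also have "(\<Sum>n. \<bar>x (n + N) - y (n + N)\<bar>) \<le> (\<Sum>n. x (n + N) + y (n + N))"
  proof (rule suminf_le)
    show "\<bar>x (n + N) - y (n + N)\<bar> \<le> x (n + N) + y (n + N)" for n using x(1)[of "n + N"] y(1)[of "n + N"] by linarith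
    show "summable (\<lambda>n. \<bar>x (n + N) - y (n + N)\<bar>)" by (rule summable_ignore_initial_segment[OF s])
    show "summable (\<lambda>n. x (n + N) + y (n + N))" by (rule summable_add[OF xN])
  qed
  also have "\<dots> = (1 - (\<Sum>n<N. x n)) + (1 - (\<Sum>n<N. y n))"
    using suminf_add[OF xN] suminf_minus_initial_segment[OF xs(1), of N] suminf_minus_initial_segment[OF xs(2), of N] x y
    by (simp add: sums_iff)
  finally have "l1_norm (\<lambda>n. x n - y n) \<le> (1 - (\<Sum>n<N. x n)) + (1 - (\<Sum>n<N. y n)) + (\<Sum>n<N. \<bar>x n - y n\<bar>)"
    by simp
  moreover have "(\<Sum>n<N. y n) - (\<Sum>n<N. x n) \<le> (\<Sum>n<N. \<bar>x n - y n\<bar>)"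
    unfolding sum_subtractf[symmetric] by (intro sum_mono) auto
  ultimately show ?thesis by (simp add: algebra_simps)
qed

text \<open>Abel summation with boundary term N R_N. This term is nonnegative, so the partial sums
  of the mean are bounded by the sum of the tails; once the mean converges, N R_N is at most the
  remainder of its series and tends to zero.\<close>

lemma mean_eq_sum_tails:
  assumes x: "\<And>n. 0 \<le> x n" "x sums (1::real)" and T: "summable (\<lambda>k. 1 - (\<Sum>i<Suc k. x i))"
  shows "summable (\<lambda>n. real n * x n)" and "mean x = (\<Sum>k. 1 - (\<Sum>i<Suc k. x i))"
proof -
  define R where "R k = 1 - (\<Sum>i<Suc k. x i)" for k
  have xs: "summable x" "suminf x = 1" using x by (auto simp: sums_iff)
  have Req: "R k = (\<Sum>i. x (i + Suc k))" for k
    using suminf_minus_initial_segment[OF xs(1), of "Suc k"] xs(2) by (simp add: R_def)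
  have R0: "0 \<le> R k" for k
    unfolding Req using x xs by (intro suminf_nonneg summable_ignore_initial_segment) auto
  have RS: "summable R" using T by (simp add: R_def[abs_def])
  have part: "(\<Sum>k<N. R k) = (\<Sum>n<Suc N. real n * x n) + real N * R N" for N
  proof (induction N)
    case (Suc N)
    have "R N = x (Suc N) + R (Suc N)" by (simp add: R_def)
    then show ?case using Suc by (simp add: algebra_simps)
  qed simp
  show sx: "summable (\<lambda>n. real n * x n)"
  proof (rule bounded_imp_summable)
    show "0 \<le> real n * x n" for n using x by simp
    show "(\<Sum>n\<le>N. real n * x n) \<le> suminf R" for N
    proof -
      have "(\<Sum>n\<le>N. real n * x n) \<le> (\<Sum>k<N. R k)" using part[of N] R0[of N] by (simp add: lessThan_Suc_atMost)
      also have "\<dots> \<le> suminf R" using R0 by (intro sum_le_suminf RS) auto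
      finally show ?thesis .
    qed
  qed
  have tail: "real N * R N \<le> suminf (\<lambda>n. real n * x n) - (\<Sum>n<Suc N. real n * x n)" for N
  proof -
    have "real N * R N = (\<Sum>i. real N * x (i + Suc N))"
      unfolding Req using xs by (intro suminf_mult[symmetric] summable_ignore_initial_segment)
    also have "\<dots> \<le> (\<Sum>i. real (i + Suc N) * x (i + Suc N))"
    proof (rule suminf_le)
      show "real N * x (i + Suc N) \<le> real (i + Suc N) * x (i + Suc N)" for i using x by (intro mult_right_mono) auto
      show "summable (\<lambda>i. real N * x (i + Suc N))"
        using xs by (intro summable_mult summable_ignore_initial_segment)
      show "summable (\<lambda>i. real (i + Suc N) * x (i + Suc N))" by (rule summable_ignore_initial_segment[OF sx])
    qed
    finally show ?thesis using suminf_minus_initial_segment[OF sx, of "Suc N"] by simp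
  qed
  have "(\<lambda>N. \<Sum>n<Suc N. real n * x n) \<longlonglongrightarrow> suminf (\<lambda>n. real n * x n)"
    using summable_LIMSEQ[OF sx] by (rule LIMSEQ_Suc)
  then have "(\<lambda>N. suminf (\<lambda>n. real n * x n) - (\<Sum>n<Suc N. real n * x n)) \<longlonglongrightarrow> 0"
    using tendsto_diff[OF tendsto_const] by (metis diff_self)
  then have 0: "(\<lambda>N. real N * R N) \<longlonglongrightarrow> 0"
    by (rule tendsto_sandwich[OF _ _ tendsto_const, rotated 2]) (use tail R0 in auto)
  have "(\<lambda>N. \<Sum>k<N. R k) \<longlonglongrightarrow> suminf (\<lambda>n. real n * x n) + 0"
    unfolding part by (intro tendsto_add 0 LIMSEQ_Suc[OF summable_LIMSEQ[OF sx]])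
  then have "suminf R = suminf (\<lambda>n. real n * x n)"
    using summable_LIMSEQ[OF RS] LIMSEQ_unique by fastforce
  then show "mean x = (\<Sum>k. 1 - (\<Sum>i<Suc k. x i))" by (simp add: mean_def R_def[abs_def])
qed

context active_batch_queue
begin

lemma Mu_at_top: "filterlim Mu at_top at_top"
proof (rule filterlim_at_top_mono)
  show "filterlim (\<lambda>t. - Mu 1 + t * Mu 1) at_top at_top"
    by (intro filterlim_tendsto_add_at_top[OF tendsto_const] filterlim_at_top_mult_tendsto_pos[OF tendsto_const Mu_1_pos] filterlim_ident)
  show "\<forall>\<^sub>F t in at_top. - Mu 1 + t * Mu 1 \<le> Mu t"
    using eventually_ge_at_top[of 0]
  proof eventually_elim
    case (elim t)
    then show ?case using Mu_linear[OF elim] by (auto simp: abs_le_iff algebra_simps)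
  qed
qed

lemma summable_envelope: "summable (\<lambda>k. envelope_bound * q ^ k)"
  using q by (intro summable_mult summable_geometric) auto

lemma stationary_mean:
  assumes t: "0 \<le> t"
  shows "summable (\<lambda>k. tail k t)" "mean (stationary t) = (\<Sum>k. tail k t)"
proof -
  have eq: "1 - (\<Sum>i<Suc k. stationary t i) = tail k t" for k
    using cumulative_stationary[of k t] by (simp add: cumulative_def)
  show s: "summable (\<lambda>k. tail k t)"
    by (rule summable_comparison_test[OF _ summable_envelope]) (use tail_nonneg[OF t] tail_geometric[OF t] in auto)
  show "mean (stationary t) = (\<Sum>k. tail k t)"
    using mean_eq_sum_tails(2)[of "stationary t"] stationary_probability[OF t] s
    unfolding eq by (auto simp: probability_vector_def)
qed

section \<open>The gap between a solution and the periodic distribution\<close>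

context
  fixes p :: "real \<Rightarrow> nat \<Rightarrow> real"
  assumes p: "forward_solution b lam mu p" and p0: "probability_vector b (p 0)"
begin

definition gap :: "nat \<Rightarrow> real \<Rightarrow> real" where
  "gap k t = cumulative p k t - cumulative stationary k t"

text \<open>Tail mass of the initial vector plus tail mass of the periodic one. It dominates |gap k
  0|, a difference of these two, and is nonincreasing in \<open>k\<close> as
  \<open>maximum_principle\<close> demands.\<close>

definition gap_bound :: "nat \<Rightarrow> real" where
  "gap_bound k = (1 - cumulative p k 0) + tail k 0"

lemma initial_nonneg: "0 \<le> p 0 n" and initial_sums: "p 0 sums 1"
  using p0 by (auto simp: probability_vector_def)

lemma initial_cumulative_nonneg: "0 \<le> cumulative p k 0"
  unfolding cumulative_def by (intro sum_nonneg initial_nonneg)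

lemma initial_cumulative_le_1: "cumulative p k 0 \<le> 1"
  unfolding cumulative_def using initial_sums sum_le_suminf[of "p 0" "{..<Suc k}"] initial_nonneg
  by (auto simp: sums_iff)

lemma gap_primitive: "ac_primitive (gap k) (\<lambda>t. - rate k t * gap k t + mu t * gap (Suc k) t)"
  unfolding gap_def[abs_def]
  by (rule ac_primitive_cong[OF ac_primitive_diff[OF cumulative_primitive[OF p] cumulative_stationary_primitive]])
     (simp add: algebra_simps)

lemma gap_bound_nonneg: "0 \<le> gap_bound k"
  using initial_cumulative_le_1[of k] tail_nonneg[of 0 k] by (simp add: gap_bound_def)

lemma gap_bound_antimono: "antimono gap_bound"
proof (rule decseq_SucI)
  show "gap_bound (Suc k) \<le> gap_bound k" for k
    using initial_nonneg[of "Suc k"] tail_antimono[of 0 k] by (simp add: gap_bound_def cumulative_def)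
qed

lemma abs_gap_le:
  assumes t: "0 \<le> t"
  shows "\<bar>gap k t\<bar> \<le> gap_bound k"
proof -
  obtain K where K: "\<And>k s. 0 \<le> s \<Longrightarrow> s \<le> t \<Longrightarrow> \<bar>cumulative p k s\<bar> \<le> K" using cumulative_bounded[OF p] by blast
  have bounded: "\<bar>gap k s\<bar> \<le> K + 1" if "0 \<le> s" "s \<le> t" for k s
    using K[OF that, of k] tail_nonneg[OF that(1), of k] tail_le_1[OF that(1), of k]
    unfolding gap_def cumulative_stationary by linarith
  have init: "\<bar>gap k 0\<bar> \<le> gap_bound k" for k
    using initial_cumulative_le_1[of k] tail_nonneg[of 0 k]
    unfolding gap_def gap_bound_def cumulative_stationary by linarith
  have "- gap_bound k \<le> gap k t"
  proof (rule maximum_principle[where a = rate, OF gap_primitive Rate_primitive Mu_primitive _ mu_le_rate mu_nonneg _ _ gap_bound_antimono gap_bound_nonneg t order_refl])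
    show "- (K + 1) \<le> gap k s" if "0 \<le> s" "s \<le> t" for k s using bounded[OF that, of k] by linarith
    show "- gap_bound k \<le> gap k 0" for k using init[of k] by linarith
  qed simp
  moreover have "- gap_bound k \<le> - gap k t"
  proof (rule maximum_principle[where a = rate, OF ac_primitive_minus[OF gap_primitive] Rate_primitive Mu_primitive _ mu_le_rate mu_nonneg _ _ gap_bound_antimono gap_bound_nonneg t order_refl])
    show "- (K + 1) \<le> - gap k s" if "0 \<le> s" "s \<le> t" for k s using bounded[OF that, of k] by linarith
    show "- gap_bound k \<le> - gap k 0" for k using init[of k] by linarith
  qed simp
  ultimately show ?thesis by (simp add: abs_le_iff)
qed

lemma cumulative_initial_tendsto: "(\<lambda>k. cumulative p k 0) \<longlonglongrightarrow> 1"
  using initial_sums sums_iff_cumulative by blast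

lemma gap_bound_tendsto_0: "gap_bound \<longlonglongrightarrow> 0"
  unfolding gap_bound_def[abs_def]
  using tendsto_add[OF tendsto_diff[OF tendsto_const[of 1] cumulative_initial_tendsto] tail_tendsto_0[of 0]] by simp

lemma cumulative_nonneg:
  assumes t: "0 \<le> t"
  shows "0 \<le> cumulative p k t"
proof -
  obtain K where K: "\<And>k s. 0 \<le> s \<Longrightarrow> s \<le> t \<Longrightarrow> \<bar>cumulative p k s\<bar> \<le> K" using cumulative_bounded[OF p] by blast
  have "- 0 \<le> cumulative p k t"
  proof (rule maximum_principle[where a = rate and S = "\<lambda>_. 0",
        OF cumulative_primitive[OF p] Rate_primitive Mu_primitive _ mu_le_rate mu_nonneg _ _ _ _ t order_refl])
    show "- K \<le> cumulative p k s" if "0 \<le> s" "s \<le> t" for k s using K[OF that, of k] by linarith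
  qed (use initial_cumulative_nonneg in \<open>auto simp: antimono_def\<close>)
  then show ?thesis by simp
qed

text \<open>State 0 is the partial sum of index 0. For a state k + 1 the arrivals from below form
  the term lam b_(k+1) times a partial sum, already known to be nonnegative; dropping it leaves an
  inequality of the form in \<open>maximum_principle\<close>. The index is shifted because state 0
  has no outflow by service.\<close>

lemma solution_nonneg:
  assumes t: "0 \<le> t"
  shows "0 \<le> p t n"
proof (cases n)
  case 0
  then show ?thesis using cumulative_nonneg[OF t, of 0] by (simp add: cumulative_def)
next
  case (Suc k)
  obtain K where K: "\<And>k s. 0 \<le> s \<Longrightarrow> s \<le> t \<Longrightarrow> \<bar>cumulative p k s\<bar> \<le> K" using cumulative_bounded[OF p] by blast
  have "- 0 \<le> p t (Suc k)"
  proof (rule maximum_principle[where g = "\<lambda>k t. p t (Suc k)" and a = "\<lambda>k. rate (Suc k)" and S = "\<lambda>_. 0",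
        OF solution_component_primitive[OF p] Rate_primitive Mu_primitive _ mu_le_rate mu_nonneg _ _ _ _ t order_refl])
    show "- rate (Suc k) s * p s (Suc k) + mu s * p s (Suc (Suc k)) \<le> A s (p s) (Suc k)" if s: "0 \<le> s" for k s
    proof -
      have "0 \<le> lam s * b (Suc k) * cumulative p k s"
        using lam_nonneg[OF s] b_nonneg[of "Suc k"] cumulative_nonneg[OF s, of k] by simp
      then show ?thesis
        using forward_operator_eq[of "p s" s "Suc k", OF solution_outside[OF p s]]
        by (simp add: rate_def cumulative_def algebra_simps)
    qed
    show "- (2 * K) \<le> p s (Suc k)" if "0 \<le> s" "s \<le> t" for k s
      using K[OF that, of k] K[OF that, of "Suc k"] by (simp add: cumulative_def abs_le_iff)
  qed (use initial_nonneg in \<open>auto simp: antimono_def\<close>)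
  then show ?thesis using Suc by simp
qed

text \<open>Conservation of mass is obtained by comparison: at each time the gap is at most
  \<open>gap_bound k\<close>, which vanishes as \<open>k\<close> grows, so the partial sums have the
  same limit as those of \<open>stationary\<close>.\<close>

lemma solution_probability: "0 \<le> t \<Longrightarrow> probability_vector b (p t)"
  unfolding probability_vector_def sums_iff_cumulative
proof (intro conjI allI impI)
  assume t: "0 \<le> t"
  show "p t n = 0" if "n \<notin> X" for n by (rule solution_outside[OF p t that])
  show "0 \<le> p t n" for n by (rule solution_nonneg[OF t])
  have "(\<lambda>k. gap k t) \<longlonglongrightarrow> 0"
    by (rule Lim_null_comparison[OF _ gap_bound_tendsto_0]) (use abs_gap_le[OF t] in auto)
  then have "(\<lambda>k. gap k t + (1 - tail k t)) \<longlonglongrightarrow> 0 + (1 - 0)"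
    by (intro tendsto_intros tail_tendsto_0 t)
  then show "(\<lambda>k. cumulative p k t) \<longlonglongrightarrow> 1" by (simp add: gap_def cumulative_stationary)
qed

text \<open>Half of \<open>e\<close> goes to the induction hypothesis at \<open>Suc k\<close>, valid
  from a time \<open>r\<close> on. The other half absorbs
  \<open>gap_bound k * exp (Mu r - Mu t)\<close>, the memory of the state at \<open>r\<close>, which
  fades because \<open>Mu\<close> tends to infinity.\<close>

lemma gap_eventually_le:
  assumes "0 < e"
  shows "\<forall>\<^sub>F t in at_top. \<bar>gap k t\<bar> \<le> gap_bound (k + j) + e"
  using assms
proof (induction j arbitrary: k e)
  case 0
  show ?case
    using eventually_ge_at_top[of 0]
  proof eventually_elim
    case (elim t)
    then show ?case using abs_gap_le[OF elim, of k] 0 by simp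
  qed
next
  case (Suc j)
  define K where "K = gap_bound (Suc k + j) + e / 2"
  have "\<forall>\<^sub>F t in at_top. \<bar>gap (Suc k) t\<bar> \<le> K" unfolding K_def using Suc.prems by (intro Suc.IH) simp
  then obtain r' where r': "\<And>t. r' \<le> t \<Longrightarrow> \<bar>gap (Suc k) t\<bar> \<le> K" by (auto simp: eventually_at_top_linorder)
  define r where "r = max r' 0"
  have r: "0 \<le> r" "\<And>t. r \<le> t \<Longrightarrow> \<bar>gap (Suc k) t\<bar> \<le> K" using r' by (auto simp: r_def)
  have K: "0 \<le> K" unfolding K_def using gap_bound_nonneg[of "Suc k + j"] Suc.prems by simp
  have bound: "\<bar>gap k t\<bar> \<le> gap_bound k * exp (Mu r - Mu t) + K" if t: "r \<le> t" for t
  proof -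
    have mono: "Mu r \<le> Mu s" if "r \<le> s" for s using Mu_mono[OF r(1) that] .
    have low: "- K * mu s \<le> mu s * gap (Suc k) s" "- K * mu s \<le> - (mu s * gap (Suc k) s)" if "r \<le> s" for s
    proof -
      have "mu s * \<bar>gap (Suc k) s\<bar> \<le> mu s * K"
        using r(2)[OF that] mu_nonneg[of s] r(1) that by (intro mult_left_mono) auto
      then have "\<bar>mu s * gap (Suc k) s\<bar> \<le> mu s * K" using mu_nonneg[of s] r(1) that by (simp add: abs_mult)
      then show "- K * mu s \<le> mu s * gap (Suc k) s" "- K * mu s \<le> - (mu s * gap (Suc k) s)"
        by (simp_all add: abs_le_iff mult.commute)
    qed
    have "- (gap_bound k * exp (Mu r - Mu t) + K * (1 - exp (Mu r - Mu t))) \<le> gap k t"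
    proof (rule relaxation_lower_bound[OF gap_primitive Rate_primitive Mu_primitive])
      show "- rate k s * gap k s - mu s * K \<le> - rate k s * gap k s + mu s * gap (Suc k) s" if "r \<le> s" for s
        using low(1)[OF that] by (simp add: mult.commute)
      show "- gap_bound k \<le> gap k r" using abs_gap_le[OF r(1), of k] by linarith
    qed (use mono t r K gap_bound_nonneg mu_le_rate in auto)
    moreover have "- (gap_bound k * exp (Mu r - Mu t) + K * (1 - exp (Mu r - Mu t))) \<le> - gap k t"
    proof (rule relaxation_lower_bound[OF ac_primitive_minus[OF gap_primitive] Rate_primitive Mu_primitive])
      show "- rate k s * - gap k s - mu s * K \<le> - (- rate k s * gap k s + mu s * gap (Suc k) s)" if "r \<le> s" for s
        using low(2)[OF that] by (simp add: mult.commute)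
      show "- gap_bound k \<le> - gap k r" using abs_gap_le[OF r(1), of k] by linarith
    qed (use mono t r K gap_bound_nonneg mu_le_rate in auto)
    moreover have "K * (1 - exp (Mu r - Mu t)) \<le> K * 1" using K by (intro mult_left_mono) auto
    ultimately show ?thesis by (intro abs_leI) linarith+
  qed
  have "filterlim (\<lambda>t. Mu r - Mu t) at_bot at_top"
    using filterlim_tendsto_add_at_top[OF tendsto_const[of "- Mu r"] Mu_at_top]
    by (simp add: filterlim_uminus_at_top)
  then have "((\<lambda>t. gap_bound k * exp (Mu r - Mu t)) \<longlongrightarrow> gap_bound k * 0) at_top"
    by (intro tendsto_mult tendsto_const filterlim_compose[OF exp_at_bot])
  then have "\<forall>\<^sub>F t in at_top. gap_bound k * exp (Mu r - Mu t) < e / 2"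
    using Suc.prems by (intro order_tendstoD(2)) auto
  then show ?case
    using eventually_ge_at_top[of r]
  proof eventually_elim
    case (elim t)
    then show ?case using bound[OF elim(2)] by (simp add: K_def)
  qed
qed

lemma gap_tendsto_0: "((\<lambda>t. gap k t) \<longlongrightarrow> 0) at_top"
proof (rule tendstoI)
  fix e :: real assume e: "0 < e"
  have "(\<lambda>j. gap_bound (k + j)) \<longlonglongrightarrow> 0"
    using LIMSEQ_ignore_initial_segment[OF gap_bound_tendsto_0, of k] by (simp add: add.commute)
  then have "\<forall>\<^sub>F j in sequentially. gap_bound (k + j) < e / 2" using e by (intro order_tendstoD(2)) auto
  then obtain j where "gap_bound (k + j) < e / 2" by (auto simp: eventually_sequentially)
  moreover have "\<forall>\<^sub>F t in at_top. \<bar>gap k t\<bar> \<le> gap_bound (k + j) + e / 2" using e by (intro gap_eventually_le) simp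
  ultimately show "\<forall>\<^sub>F t in at_top. dist (gap k t) 0 < e"
    by (auto elim!: eventually_mono)
qed

lemma component_diff_tendsto_0: "((\<lambda>t. p t n - stationary t n) \<longlongrightarrow> 0) at_top"
proof (cases n)
  case 0
  then show ?thesis using gap_tendsto_0[of 0] by (simp add: gap_def[abs_def] cumulative_def)
next
  case (Suc k)
  have "((\<lambda>t. gap (Suc k) t - gap k t) \<longlongrightarrow> 0 - 0) at_top" by (intro tendsto_diff gap_tendsto_0)
  then show ?thesis by (simp add: gap_def[abs_def] cumulative_def Suc)
qed

text \<open>The geometric bound gives a cutoff \<open>N\<close> independent of time beyond which
  \<open>stationary\<close> has little mass; by \<open>l1_norm_diff_le\<close> convergence of the
  finitely many coordinates up to \<open>N\<close> then suffices.\<close>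

lemma l1_convergence: "((\<lambda>t. l1_norm (\<lambda>n. p t n - stationary t n)) \<longlongrightarrow> 0) at_top"
proof (rule tendstoI)
  fix e :: real assume e: "0 < e"
  have "(\<lambda>k. envelope_bound * q ^ k) \<longlonglongrightarrow> 0"
    using q by (intro tendsto_mult_right_zero LIMSEQ_power_zero) auto
  then have "\<forall>\<^sub>F k in sequentially. envelope_bound * q ^ k < e / 4" using e by (intro order_tendstoD(2)) auto
  then obtain N where N: "envelope_bound * q ^ N < e / 4" by (auto simp: eventually_sequentially)
  have "((\<lambda>t. \<Sum>n<Suc N. \<bar>p t n - stationary t n\<bar>) \<longlongrightarrow> (\<Sum>n<Suc N. \<bar>0\<bar>)) at_top"
    by (intro tendsto_sum tendsto_rabs component_diff_tendsto_0)
  then have "\<forall>\<^sub>F t in at_top. (\<Sum>n<Suc N. \<bar>p t n - stationary t n\<bar>) < e / 4"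
    using e by (intro order_tendstoD(2)) auto
  then show "\<forall>\<^sub>F t in at_top. dist (l1_norm (\<lambda>n. p t n - stationary t n)) 0 < e"
    using eventually_ge_at_top[of 0]
  proof eventually_elim
    case (elim t)
    note pv = solution_probability[OF elim(2)] stationary_probability[OF elim(2)]
    have "l1_norm (\<lambda>n. p t n - stationary t n)
        \<le> 2 * (\<Sum>n<Suc N. \<bar>p t n - stationary t n\<bar>) + 2 * (1 - (\<Sum>n<Suc N. stationary t n))"
      using pv by (intro l1_norm_diff_le) (auto simp: probability_vector_def)
    also have "1 - (\<Sum>n<Suc N. stationary t n) = tail N t"
      using cumulative_stationary[of N t] by (simp add: cumulative_def)
    also have "\<dots> \<le> envelope_bound * q ^ N" by (rule tail_geometric[OF elim(2)])
    finally have "l1_norm (\<lambda>n. p t n - stationary t n) < e" using elim(1) N by linarith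
    moreover have "summable (\<lambda>n. \<bar>p t n - stationary t n\<bar>)"
      using pv by (intro summable_abs_diff) (auto simp: probability_vector_def sums_iff)
    then have "0 \<le> l1_norm (\<lambda>n. p t n - stationary t n)" unfolding l1_norm_def by (intro suminf_nonneg) auto
    ultimately show ?case by simp
  qed
qed

text \<open>By \<open>mean_eq_sum_tails\<close> both means are sums of tails, so their difference is
  minus the sum of the gaps. The initial part of \<open>gap_bound\<close> is zero from
  \<open>k0\<close> on, which leaves the summable tails of \<open>stationary\<close> as
  majorant.\<close>

lemma mean_convergence:
  assumes k0: "p 0 k0 = 1"
  shows "0 \<le> t \<Longrightarrow> summable (\<lambda>n. real n * p t n)"
    and "((\<lambda>t. mean (p t) - mean (stationary t)) \<longlongrightarrow> 0) at_top"
proof -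
  have one: "cumulative p k 0 = 1" if "k0 \<le> k" for k
  proof -
    have "p 0 k0 \<le> cumulative p k 0"
      unfolding cumulative_def using that by (intro member_le_sum initial_nonneg) auto
    then show ?thesis using initial_cumulative_le_1[of k] k0 by simp
  qed
  have S: "summable gap_bound"
    unfolding gap_bound_def[abs_def]
  proof (rule summable_add)
    show "summable (\<lambda>k. 1 - cumulative p k 0)"
      by (rule summable_finite[of "{..k0}"]) (use one in auto)
    show "summable (\<lambda>k. tail k 0)" by (rule stationary_mean) simp
  qed
  have eq: "1 - (\<Sum>i<Suc k. p t i) = tail k t - gap k t" for k t
    unfolding gap_def cumulative_stationary by (simp add: cumulative_def)
  have gs: "summable (\<lambda>k. gap k t)" if "0 \<le> t" for t
    by (rule summable_comparison_test[OF _ S]) (use abs_gap_le[OF that] in auto)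
  have m: "summable (\<lambda>n. real n * p t n)" "mean (p t) = (\<Sum>k. tail k t) - (\<Sum>k. gap k t)" if t: "0 \<le> t" for t
  proof -
    have pv: "\<And>n. 0 \<le> p t n" "p t sums 1" using solution_probability[OF t] by (auto simp: probability_vector_def)
    have s: "summable (\<lambda>k. tail k t - gap k t)" by (intro summable_diff stationary_mean gs t)
    show "summable (\<lambda>n. real n * p t n)" using mean_eq_sum_tails(1)[OF pv] s unfolding eq by blast
    have "mean (p t) = (\<Sum>k. tail k t - gap k t)" using mean_eq_sum_tails(2)[OF pv] s unfolding eq by blast
    then show "mean (p t) = (\<Sum>k. tail k t) - (\<Sum>k. gap k t)"
      using suminf_diff[OF stationary_mean(1)[OF t] gs[OF t]] by simp
  qed
  then show "0 \<le> t \<Longrightarrow> summable (\<lambda>n. real n * p t n)" by blast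
  have "((\<lambda>t. \<Sum>k. gap k t) \<longlongrightarrow> (\<Sum>k. 0)) at_top"
  proof (rule tannerys_theorem[THEN conjunct2, THEN conjunct2, OF gap_tendsto_0 _ S])
    have "\<forall>\<^sub>F t in at_top. \<forall>k. norm (gap k t) \<le> gap_bound k"
      using eventually_ge_at_top[of 0] by eventually_elim (use abs_gap_le in auto)
    then show "\<forall>\<^sub>F (k, t) in sequentially \<times>\<^sub>F at_top. norm (gap k t) \<le> gap_bound k"
      unfolding eventually_prod_filter by (intro exI[of _ "\<lambda>_. True"] exI) auto
  qed simp
  then have "((\<lambda>t. - (\<Sum>k. gap k t)) \<longlongrightarrow> - 0) at_top" by (intro tendsto_minus) simp
  then have "((\<lambda>t. - (\<Sum>k. gap k t)) \<longlongrightarrow> 0) at_top" by simp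
  then show "((\<lambda>t. mean (p t) - mean (stationary t)) \<longlongrightarrow> 0) at_top"
  proof (rule Lim_transform_eventually)
    show "\<forall>\<^sub>F t in at_top. - (\<Sum>k. gap k t) = mean (p t) - mean (stationary t)"
      using eventually_ge_at_top[of 0] by eventually_elim (simp add: m stationary_mean)
  qed
qed

end

end

section \<open>Divergence of the total service in terms of one period\<close>

context batch_queue
begin

lemma Mu_nat: "Mu (real n) = real n * Mu 1"
proof (induction n)
  case (Suc n)
  have "Mu (real (Suc n)) = Mu (real n + 1)" by (simp add: add.commute)
  then show ?case using Mu_shift[of "real n"] Suc by (simp add: algebra_simps)
qed simp

lemma set_integrable_mu: "set_integrable lebesgue {0..real n} mu"
  using mu_loc_integrable[of "real n"] by simp

lemma nn_integral_mu_nat: "(\<integral>\<^sup>+t. ennreal (indicator {0..real n} t * mu t) \<partial>lebesgue) = ennreal (real n * Mu 1)"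
proof -
  have "(\<integral>\<^sup>+t. ennreal (indicator {0..real n} t * mu t) \<partial>lebesgue) = ennreal (LINT t|lebesgue. indicator {0..real n} t * mu t)"
    using set_integrable_mu[of n] mu_nonneg
    by (intro nn_integral_eq_integral) (auto simp: set_integrable_def indicator_def)
  also have "(LINT t|lebesgue. indicator {0..real n} t * mu t) = Mu (real n)"
    using set_lebesgue_integral_eq_integral(2)[OF set_integrable_mu[of n]]
    by (simp add: set_lebesgue_integral_def Mu_def)
  finally show ?thesis by (simp add: Mu_nat)
qed

text \<open>The integral over [0, n] is n times that over one period. If the latter is positive,
  these values are unbounded; if it is zero, \<open>mu\<close> vanishes almost everywhere on each
  [0, n], hence on the whole half-line.\<close>

lemma nn_integral_mu_infinite_iff:
  "(\<integral>\<^sup>+t\<in>{0..}. ennreal (mu t) \<partial>lebesgue) = \<infinity> \<longleftrightarrow> 0 < Mu 1"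
proof
  assume pos: "0 < Mu 1"
  have "ennreal (real n) \<le> (\<integral>\<^sup>+t\<in>{0..}. ennreal (mu t) \<partial>lebesgue)" for n
  proof -
    obtain m :: nat where "real n / Mu 1 \<le> real m" using real_arch_simple by blast
    then have "ennreal (real n) \<le> ennreal (real m * Mu 1)"
      using pos by (intro ennreal_leI) (simp add: field_simps)
    also have "\<dots> \<le> (\<integral>\<^sup>+t\<in>{0..}. ennreal (mu t) \<partial>lebesgue)"
      unfolding nn_integral_mu_nat[symmetric] by (intro nn_integral_mono) (auto simp: indicator_def)
    finally show ?thesis .
  qed
  then have "\<not> (\<integral>\<^sup>+t\<in>{0..}. ennreal (mu t) \<partial>lebesgue) < of_nat n" for n
    by (simp add: not_less ennreal_of_nat_eq_real_of_nat)
  then show "(\<integral>\<^sup>+t\<in>{0..}. ennreal (mu t) \<partial>lebesgue) = \<infinity>"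
    using ennreal_Ex_less_of_nat[of "\<integral>\<^sup>+t\<in>{0..}. ennreal (mu t) \<partial>lebesgue"]
    by (auto simp: less_top[symmetric])
next
  assume inf: "(\<integral>\<^sup>+t\<in>{0..}. ennreal (mu t) \<partial>lebesgue) = \<infinity>"
  show "0 < Mu 1"
  proof (rule ccontr)
    assume "\<not> 0 < Mu 1"
    then have Mu1: "Mu 1 = 0" using Mu_mono[of 0 1] by simp
    have "AE t in lebesgue. ennreal (indicator {0..real n} t * mu t) = 0" for n
    proof (subst nn_integral_0_iff_AE[symmetric])
      have "(\<lambda>t. indicator {0..real n} t * mu t) \<in> borel_measurable lebesgue"
        using set_integrable_mu[of n] by (auto simp: set_integrable_def)
      then show "(\<lambda>t. ennreal (indicator {0..real n} t * mu t)) \<in> borel_measurable lebesgue" by simp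
      show "(\<integral>\<^sup>+t. ennreal (indicator {0..real n} t * mu t) \<partial>lebesgue) = 0"
        unfolding nn_integral_mu_nat using Mu1 by simp
    qed
    then have "AE t in lebesgue. \<forall>n. ennreal (indicator {0..real n} t * mu t) = 0"
      unfolding AE_all_countable by blast
    then have "AE t in lebesgue. ennreal (mu t) * indicator {0..} t = 0"
    proof eventually_elim
      case (elim t)
      obtain n where "t \<le> real n" using real_arch_simple by blast
      then show ?case using elim[rule_format, of n] by (auto simp: indicator_def)
    qed
    then have "(\<integral>\<^sup>+t\<in>{0..}. ennreal (mu t) \<partial>lebesgue) = (\<integral>\<^sup>+t. 0 \<partial>(lebesgue :: real measure))"
      by (rule nn_integral_cong_AE)
    then show False using inf by simp
  qed
qed

end

theorem corollary3:
  fixes b :: "nat \<Rightarrow> real" and lam mu :: "real \<Rightarrow> real" and L C q :: real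
  assumes lam_nonneg: "\<And>t. t \<ge> 0 \<Longrightarrow> 0 \<le> lam t"
    and lam_bounded: "\<And>t. t \<ge> 0 \<Longrightarrow> lam t \<le> L"
    and lam_loc_integrable: "\<And>T. T \<ge> 0 \<Longrightarrow> lam absolutely_integrable_on {0..T}"
    and mu_nonneg: "\<And>t. t \<ge> 0 \<Longrightarrow> 0 \<le> mu t"
    and mu_loc_integrable: "\<And>T. T \<ge> 0 \<Longrightarrow> mu absolutely_integrable_on {0..T}"
    and batch: "batch_distribution b"
    and q: "0 < q" "q < 1"
    and C: "C > 0"
    and b_geometric: "\<And>k. k \<ge> 1 \<Longrightarrow> b k \<le> C * q ^ k"
    and lam_periodic: "\<And>t. t \<ge> 0 \<Longrightarrow> lam (t + 1) = lam t"
    and mu_periodic: "\<And>t. t \<ge> 0 \<Longrightarrow> mu (t + 1) = mu t"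
  shows "((\<integral>\<^sup>+t\<in>{0..}. ennreal (mu t) \<partial>lebesgue) = \<infinity> \<longleftrightarrow> (LINT t:{0..1}|lebesgue. mu t) > 0) \<and>
    ((\<integral>\<^sup>+t\<in>{0..}. ennreal (mu t) \<partial>lebesgue) = \<infinity> \<longrightarrow>
      (\<exists>\<pi> :: real \<Rightarrow> nat \<Rightarrow> real.
         forward_solution b lam mu \<pi> \<and>
         (\<forall>t\<ge>0. probability_vector b (\<pi> t)) \<and>
         (\<forall>t\<ge>0. \<pi> (t + 1) = \<pi> t) \<and>
         (\<forall>p. forward_solution b lam mu p \<and> probability_vector b (p 0) \<longrightarrow>
            ((\<lambda>t. l1_norm (\<lambda>n. p t n - \<pi> t n)) \<longlongrightarrow> 0) at_top)) \<and>
      (\<exists>\<phi> :: real \<Rightarrow> real.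
         (\<forall>t\<ge>0. \<phi> (t + 1) = \<phi> t) \<and>
         (\<forall>k\<in>state_space b. \<forall>p. forward_solution b lam mu p \<and> probability_vector b (p 0) \<and> p 0 k = 1 \<longrightarrow>
            (\<forall>t\<ge>0. summable (\<lambda>n. real n * p t n)) \<and>
            ((\<lambda>t. mean (p t) - \<phi> t) \<longlongrightarrow> 0) at_top)))"
proof -
  interpret batch_queue b lam mu L C q
    by unfold_locales (fact assms)+
  have Mu1: "(LINT t:{0..1}|lebesgue. mu t) = Mu 1" "integral {0..1} mu = Mu 1"
    using set_lebesgue_integral_eq_integral(2)[OF set_integrable_mu[of 1]] by (simp_all add: Mu_def)
  show ?thesis
  proof (intro conjI impI)
    show "((\<integral>\<^sup>+t\<in>{0..}. ennreal (mu t) \<partial>lebesgue) = \<infinity>) = ((LINT t:{0..1}|lebesgue. mu t) > 0)"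
      using nn_integral_mu_infinite_iff Mu1 by simp
  next
    assume "(\<integral>\<^sup>+t\<in>{0..}. ennreal (mu t) \<partial>lebesgue) = \<infinity>"
    then interpret active_batch_queue b lam mu L C q
      using nn_integral_mu_infinite_iff Mu1 by unfold_locales simp
    show "\<exists>\<pi> :: real \<Rightarrow> nat \<Rightarrow> real.
         forward_solution b lam mu \<pi> \<and>
         (\<forall>t\<ge>0. probability_vector b (\<pi> t)) \<and>
         (\<forall>t\<ge>0. \<pi> (t + 1) = \<pi> t) \<and>
         (\<forall>p. forward_solution b lam mu p \<and> probability_vector b (p 0) \<longrightarrow>
            ((\<lambda>t. l1_norm (\<lambda>n. p t n - \<pi> t n)) \<longlongrightarrow> 0) at_top)"
      using stationary_solution stationary_probability stationary_periodic l1_convergence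
      by (intro exI[of _ stationary]) blast
    show "\<exists>\<phi> :: real \<Rightarrow> real.
         (\<forall>t\<ge>0. \<phi> (t + 1) = \<phi> t) \<and>
         (\<forall>k\<in>state_space b. \<forall>p. forward_solution b lam mu p \<and> probability_vector b (p 0) \<and> p 0 k = 1 \<longrightarrow>
            (\<forall>t\<ge>0. summable (\<lambda>n. real n * p t n)) \<and>
            ((\<lambda>t. mean (p t) - \<phi> t) \<longlongrightarrow> 0) at_top)"
      using stationary_periodic mean_convergence
      by (intro exI[of _ "\<lambda>t. mean (stationary t)"]) auto
  qed
qed

end
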